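(* Let $F_0$ be a formally real field and let $F=F_0(X,Y)$ be the rational function field in two commuting variables over $F_0$. Let $A=M_3(F)\otimes_F H\cong M_3(H)$, where $H=(-1,-1)_F$ is Hamilton's quaternion division algebra over $F$. Equip $A$ with the involution $\sigma=\mathrm{ad}_q\otimes\gamma$, where $\gamma$ is quaternion conjugation on $H$ and $q$ is the quadratic form $q=\langle X,Y,XY\rangle$ over $F$. Then the algebra $A$ is central simple over $F$ of degree $6$, the involution $\sigma$ is symplectic, and the ($\sigma$-symmetric) element $XY\in F\subseteq A$ is totally $\sigma$-positive, but is not a sum of hermitian squares in $(A,\sigma)$.
   Context: For a quadratic form $q$ of dimension $n$ over $F$ with Gram matrix $G$ (for $q=\langle a_1,\dots,a_n\rangle$, $G=\mathrm{diag}(a_1,\dots,a_n)$), the adjoint involution $\mathrm{ad}_q$ on $M_n(F)$ is $\mathrm{ad}_q(Z)=G\cdot Z^t\cdot G^{-1}$, where $t$ is the transpose. $(-1,-1)_F$ is the quaternion algebra with $F$-basis $1,i,j,k$, $i^2=j^2=-1$, $ij=k=-ji$; quaternion conjugation $\gamma$ fixes $1$ and sends $i,j,k$ to $-i,-j,-k$. The field $F$ is identified with $F\cdot 1_A$. An involution $\sigma$ on a central simple $F$-algebra $A$ that is the identity on $F$ (first kind) is called symplectic if it becomes adjoint to an alternating form after scalar extension to a splitting field of $A$. Put $\mathrm{Sym}(A,\sigma)=\{a\in A:\sigma(a)=a\}$ and let $\mathrm{Trd}:A\to F$ be the reduced trace. An ordering $\leq_P$ of the field $F$ is a $\sigma$-ordering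 if $0\leq_P\mathrm{Trd}(\sigma(x)x)$ for all $x\in A$. An element $a\in\mathrm{Sym}(A,\sigma)$ is $\sigma$-positive with respect to a $\sigma$-ordering $\leq_P$ if $0\leq_P \mathrm{Trd}(\sigma(x)ax)$ for all $x\in A$; it is totally $\sigma$-positive if it is $\sigma$-positive with respect to all $\sigma$-orderings of $F$. Hermitian squares in $(A,\sigma)$ are elements of the form $\sigma(x)x$ with $x\in A$; sums are finite. *)

theory Defs
  imports
    "HOL-Algebra.Algebraic_Closure_Type"
    "HOL-Algebra.Embedded_Algebras"
    "HOL-Algebra.Ideal"
    "HOL-Computational_Algebra.Fraction_Field"
    "Jordan_Normal_Form.Matrix"
    "Jordan_Normal_Form.Gauss_Jordan_Elimination"
begin

section \<open>Central simple algebras\<close>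

text \<open>
  An algebra over a field (given as a type \<open>'f\<close> of class \<^class>\<open>field\<close>) is a ring record
  \<open>A\<close> together with its structure map \<open>e :: 'f \<Rightarrow> 'b\<close>, \<open>c \<mapsto> c \<cdot> 1\<^sub>A\<close>. The field is
  identified with its image \<open>range e\<close>, to which the library notions of linear independence,
  span and dimension are applied.
\<close>

definition field_algebra :: "('f::field \<Rightarrow> 'b) \<Rightarrow> ('b, 'c) ring_scheme \<Rightarrow> bool" where
  "field_algebra e A \<longleftrightarrow> ring A \<and> e \<in> Ring.ring_hom ring_of_type_algebra A \<and>
     (\<forall>c. \<forall>x \<in> carrier A. e c \<otimes>\<^bsub>A\<^esub> x = x \<otimes>\<^bsub>A\<^esub> e c)"

definition ring_center :: "('b, 'c) ring_scheme \<Rightarrow> 'b set" where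
  "ring_center A = {z \<in> carrier A. \<forall>x \<in> carrier A. z \<otimes>\<^bsub>A\<^esub> x = x \<otimes>\<^bsub>A\<^esub> z}"

definition simple_ring :: "('b, 'c) ring_scheme \<Rightarrow> bool" where
  "simple_ring A \<longleftrightarrow> ring A \<and> \<one>\<^bsub>A\<^esub> \<noteq> \<zero>\<^bsub>A\<^esub> \<and>
     (\<forall>I. ideal I A \<longrightarrow> I = {\<zero>\<^bsub>A\<^esub>} \<or> I = carrier A)"

definition central_simple :: "('f::field \<Rightarrow> 'b) \<Rightarrow> ('b, 'c) ring_scheme \<Rightarrow> bool" where
  "central_simple e A \<longleftrightarrow> field_algebra e A \<and> simple_ring A \<and> ring_center A = range e \<and>
     (\<exists>n. ring.dimension A n (range e) (carrier A))"

definition has_degree :: "('f::field \<Rightarrow> 'b) \<Rightarrow> ('b, 'c) ring_scheme \<Rightarrow> nat \<Rightarrow> bool" where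
  "has_degree e A d \<longleftrightarrow> ring.dimension A (d\<^sup>2) (range e) (carrier A)"

section \<open>Splitting fields and the reduced trace\<close>

definition algebra_basis :: "('f::field \<Rightarrow> 'b) \<Rightarrow> ('b, 'c) ring_scheme \<Rightarrow> 'b list \<Rightarrow> bool" where
  "algebra_basis e A bs \<longleftrightarrow>
     ring.independent A (range e) bs \<and> ring.Span A (range e) bs = carrier A"

text \<open>
  For a field extension \<open>h : F \<rightarrow> L\<close>, an \<open>F\<close>-algebra \<open>A\<close> of finite dimension and an
  \<open>L\<close>-algebra \<open>A'\<close>: the map \<open>\<phi> : A \<rightarrow> A'\<close> is an \<open>F\<close>-algebra homomorphism whose \<open>L\<close>-linear
  extension \<open>A \<otimes>\<^sub>F L \<rightarrow> A'\<close> is an isomorphism. (If \<open>bs\<close> is an \<open>F\<close>-basis of \<open>A\<close>, the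
  elements \<open>b \<otimes> 1\<close> form an \<open>L\<close>-basis of \<open>A \<otimes>\<^sub>F L\<close>.)
\<close>

definition scalar_extension ::
  "('f::field \<Rightarrow> 'l::field) \<Rightarrow> ('f \<Rightarrow> 'b) \<Rightarrow> ('b, 'c) ring_scheme \<Rightarrow>
   ('l \<Rightarrow> 'd) \<Rightarrow> ('d, 'e) ring_scheme \<Rightarrow> ('b \<Rightarrow> 'd) \<Rightarrow> bool" where
  "scalar_extension h e A e' A' \<phi> \<longleftrightarrow>
     \<phi> \<in> Ring.ring_hom A A' \<and> (\<forall>c. \<phi> (e c) = e' (h c)) \<and>
     (\<exists>bs. algebra_basis e A bs \<and> algebra_basis e' A' (map \<phi> bs))"

abbreviation mat_alg :: "'r::semiring_1 itself \<Rightarrow> nat \<Rightarrow> 'r mat ring" where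
  "mat_alg ty n \<equiv> ring_mat ty n ()"

definition scalar_mat :: "nat \<Rightarrow> 'r::semiring_1 \<Rightarrow> 'r mat" where
  "scalar_mat n c = c \<cdot>\<^sub>m 1\<^sub>m n"

text \<open>\<open>\<phi>\<close> exhibits \<open>L\<close> as a splitting field, \<open>A \<otimes>\<^sub>F L \<cong> M\<^sub>n(L)\<close>.\<close>

definition splitting ::
  "('f::field \<Rightarrow> 'l::field) \<Rightarrow> ('f \<Rightarrow> 'b) \<Rightarrow> ('b, 'c) ring_scheme \<Rightarrow> nat \<Rightarrow> ('b \<Rightarrow> 'l mat) \<Rightarrow> bool"
  where
  "splitting h e A n \<phi> \<longleftrightarrow> scalar_extension h e A (scalar_mat n) (mat_alg TYPE('l) n) \<phi>"

text \<open>
  An algebraic closure splits every central simple algebra, and neither the reduced trace nor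
  the type of an involution depends on the choice of the splitting field; we therefore split
  over the algebraic closure, \<^const>\<open>to_ac\<close> being the inclusion of the field.
\<close>

definition Trd :: "('f::field \<Rightarrow> 'b) \<Rightarrow> ('b, 'c) ring_scheme \<Rightarrow> 'b \<Rightarrow> 'f" where
  "Trd e A x = (THE c. \<exists>n \<phi>. splitting to_ac e A n \<phi> \<and> to_ac c = (\<Sum>i<n. \<phi> x $$ (i, i)))"

section \<open>Involutions\<close>

definition involution_first_kind ::
  "('f::field \<Rightarrow> 'b) \<Rightarrow> ('b, 'c) ring_scheme \<Rightarrow> ('b \<Rightarrow> 'b) \<Rightarrow> bool" where
  "involution_first_kind e A \<sigma> \<longleftrightarrow>
     \<sigma> \<in> carrier A \<rightarrow> carrier A \<and>
     (\<forall>x \<in> carrier A. \<forall>y \<in> carrier A. \<sigma> (x \<oplus>\<^bsub>A\<^esub> y) = \<sigma> x \<oplus>\<^bsub>A\<^esub> \<sigma> y) \<and>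
     (\<forall>x \<in> carrier A. \<forall>y \<in> carrier A. \<sigma> (x \<otimes>\<^bsub>A\<^esub> y) = \<sigma> y \<otimes>\<^bsub>A\<^esub> \<sigma> x) \<and>
     (\<forall>x \<in> carrier A. \<sigma> (\<sigma> x) = x) \<and>
     (\<forall>c. \<sigma> (e c) = e c)"

definition bilinear_form :: "nat \<Rightarrow> ('l::field vec \<Rightarrow> 'l vec \<Rightarrow> 'l) \<Rightarrow> bool" where
  "bilinear_form n b \<longleftrightarrow>
     (\<forall>x \<in> carrier_vec n. \<forall>y \<in> carrier_vec n. \<forall>z \<in> carrier_vec n. \<forall>c.
        b (x + y) z = b x z + b y z \<and> b z (x + y) = b z x + b z y \<and>
        b (c \<cdot>\<^sub>v x) y = c * b x y \<and> b x (c \<cdot>\<^sub>v y) = c * b x y)"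

definition nonsingular_form :: "nat \<Rightarrow> ('l::field vec \<Rightarrow> 'l vec \<Rightarrow> 'l) \<Rightarrow> bool" where
  "nonsingular_form n b \<longleftrightarrow>
     (\<forall>x \<in> carrier_vec n. x \<noteq> 0\<^sub>v n \<longrightarrow> (\<exists>y \<in> carrier_vec n. b x y \<noteq> 0))"

definition alternating_form :: "nat \<Rightarrow> ('l::field vec \<Rightarrow> 'l vec \<Rightarrow> 'l) \<Rightarrow> bool" where
  "alternating_form n b \<longleftrightarrow> bilinear_form n b \<and> (\<forall>x \<in> carrier_vec n. b x x = 0)"

definition adjoint_to_form ::
  "nat \<Rightarrow> ('l::field vec \<Rightarrow> 'l vec \<Rightarrow> 'l) \<Rightarrow> ('l mat \<Rightarrow> 'l mat) \<Rightarrow> bool" where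
  "adjoint_to_form n b \<tau> \<longleftrightarrow>
     (\<forall>M \<in> carrier_mat n n. \<tau> M \<in> carrier_mat n n \<and>
        (\<forall>x \<in> carrier_vec n. \<forall>y \<in> carrier_vec n. b x (M *\<^sub>v y) = b (\<tau> M *\<^sub>v x) y))"

text \<open>
  \<open>\<tau>\<close> is \<open>\<sigma> \<otimes> id\<^sub>L\<close>, transported along the isomorphism \<open>A \<otimes>\<^sub>F L \<cong> M\<^sub>n(L)\<close> induced by \<open>\<phi>\<close>.
\<close>

definition extended_map ::
  "('b, 'c) ring_scheme \<Rightarrow> ('b \<Rightarrow> 'b) \<Rightarrow> nat \<Rightarrow> ('b \<Rightarrow> 'l::field mat) \<Rightarrow> ('l mat \<Rightarrow> 'l mat) \<Rightarrow> bool"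
  where
  "extended_map A \<sigma> n \<phi> \<tau> \<longleftrightarrow>
     (\<forall>M \<in> carrier_mat n n. \<tau> M \<in> carrier_mat n n) \<and>
     (\<forall>M \<in> carrier_mat n n. \<forall>N \<in> carrier_mat n n. \<tau> (M + N) = \<tau> M + \<tau> N) \<and>
     (\<forall>M \<in> carrier_mat n n. \<forall>l. \<tau> (l \<cdot>\<^sub>m M) = l \<cdot>\<^sub>m \<tau> M) \<and>
     (\<forall>x \<in> carrier A. \<tau> (\<phi> x) = \<phi> (\<sigma> x))"

definition symplectic ::
  "('f::field \<Rightarrow> 'b) \<Rightarrow> ('b, 'c) ring_scheme \<Rightarrow> ('b \<Rightarrow> 'b) \<Rightarrow> bool" where
  "symplectic e A \<sigma> \<longleftrightarrow> involution_first_kind e A \<sigma> \<and>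
     (\<exists>n \<phi> \<tau> b. splitting (to_ac :: 'f \<Rightarrow> 'f alg_closure) e A n \<phi> \<and> extended_map A \<sigma> n \<phi> \<tau> \<and>
        alternating_form n b \<and> nonsingular_form n b \<and> adjoint_to_form n b \<tau>)"

section \<open>Orderings, positivity and hermitian squares\<close>

definition formally_real :: "'a::field itself \<Rightarrow> bool" where
  "formally_real _ \<longleftrightarrow> (\<nexists>xs :: 'a list. - 1 = (\<Sum>x\<leftarrow>xs. x\<^sup>2))"

definition field_ordering :: "('f::field \<Rightarrow> 'f \<Rightarrow> bool) \<Rightarrow> bool" where
  "field_ordering leq \<longleftrightarrow> class.linorder leq (\<lambda>x y. leq x y \<and> x \<noteq> y) \<and>
     (\<forall>x y z. leq x y \<longrightarrow> leq (x + z) (y + z)) \<and>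
     (\<forall>x y. leq 0 x \<longrightarrow> leq 0 y \<longrightarrow> leq 0 (x * y))"

definition Sym :: "('b, 'c) ring_scheme \<Rightarrow> ('b \<Rightarrow> 'b) \<Rightarrow> 'b set" where
  "Sym A \<sigma> = {a \<in> carrier A. \<sigma> a = a}"

definition sigma_ordering ::
  "('f::field \<Rightarrow> 'b) \<Rightarrow> ('b, 'c) ring_scheme \<Rightarrow> ('b \<Rightarrow> 'b) \<Rightarrow> ('f \<Rightarrow> 'f \<Rightarrow> bool) \<Rightarrow> bool" where
  "sigma_ordering e A \<sigma> leq \<longleftrightarrow> field_ordering leq \<and>
     (\<forall>x \<in> carrier A. leq 0 (Trd e A (\<sigma> x \<otimes>\<^bsub>A\<^esub> x)))"

definition sigma_positive ::
  "('f::field \<Rightarrow> 'b) \<Rightarrow> ('b, 'c) ring_scheme \<Rightarrow> ('b \<Rightarrow> 'b) \<Rightarrow> ('f \<Rightarrow> 'f \<Rightarrow> bool) \<Rightarrow> 'b \<Rightarrow> bool" where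
  "sigma_positive e A \<sigma> leq a \<longleftrightarrow>
     (\<forall>x \<in> carrier A. leq 0 (Trd e A (\<sigma> x \<otimes>\<^bsub>A\<^esub> a \<otimes>\<^bsub>A\<^esub> x)))"

definition totally_sigma_positive ::
  "('f::field \<Rightarrow> 'b) \<Rightarrow> ('b, 'c) ring_scheme \<Rightarrow> ('b \<Rightarrow> 'b) \<Rightarrow> 'b \<Rightarrow> bool" where
  "totally_sigma_positive e A \<sigma> a \<longleftrightarrow> a \<in> Sym A \<sigma> \<and>
     (\<forall>leq. sigma_ordering e A \<sigma> leq \<longrightarrow> sigma_positive e A \<sigma> leq a)"

definition sum_hermitian_squares :: "('b, 'c) ring_scheme \<Rightarrow> ('b \<Rightarrow> 'b) \<Rightarrow> 'b \<Rightarrow> bool" where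
  "sum_hermitian_squares A \<sigma> a \<longleftrightarrow>
     (\<exists>(n::nat) x. x \<in> {..<n} \<rightarrow> carrier A \<and> a = (\<Oplus>\<^bsub>A\<^esub> i \<in> {..<n}. \<sigma> (x i) \<otimes>\<^bsub>A\<^esub> x i))"

section \<open>The quaternion algebra $(-1,-1)_F$\<close>

text \<open>\<open>Quat a b c d\<close> is \<open>a + b i + c j + d k\<close>.\<close>

datatype 'a quat = Quat (q1: 'a) (qi: 'a) (qj: 'a) (qk: 'a)

lemma quat_eq_iff: "x = y \<longleftrightarrow> q1 x = q1 y \<and> qi x = qi y \<and> qj x = qj y \<and> qk x = qk y"
  by (auto intro: quat.expand)

instantiation quat :: (comm_ring_1) ring_1
begin

definition "0 = Quat 0 0 0 0"
definition "1 = Quat 1 0 0 0"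
definition "x + y = Quat (q1 x + q1 y) (qi x + qi y) (qj x + qj y) (qk x + qk y)"
definition "x - y = Quat (q1 x - q1 y) (qi x - qi y) (qj x - qj y) (qk x - qk y)"
definition "- x = Quat (- q1 x) (- qi x) (- qj x) (- qk x)"
definition "x * y = Quat
  (q1 x * q1 y - qi x * qi y - qj x * qj y - qk x * qk y)
  (q1 x * qi y + qi x * q1 y + qj x * qk y - qk x * qj y)
  (q1 x * qj y - qi x * qk y + qj x * q1 y + qk x * qi y)
  (q1 x * qk y + qi x * qj y - qj x * qi y + qk x * q1 y)"

instance
  by standard
    (auto simp: zero_quat_def one_quat_def plus_quat_def minus_quat_def uminus_quat_def
      times_quat_def quat_eq_iff algebra_simps)

end

lemmas quat_defs = zero_quat_def one_quat_def plus_quat_def minus_quat_def uminus_quat_def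
  times_quat_def

definition quat_I :: "'a::comm_ring_1 quat" where "quat_I = Quat 0 1 0 0"
definition quat_J :: "'a::comm_ring_1 quat" where "quat_J = Quat 0 0 1 0"
definition quat_K :: "'a::comm_ring_1 quat" where "quat_K = Quat 0 0 0 1"

definition quat_of :: "'a::comm_ring_1 \<Rightarrow> 'a quat" where
  "quat_of c = Quat c 0 0 0"

definition quat_conj :: "'a::comm_ring_1 quat \<Rightarrow> 'a quat" where
  "quat_conj x = Quat (q1 x) (- qi x) (- qj x) (- qk x)"

lemma quat_relations:
  "quat_I * quat_I = (- 1 :: 'a::comm_ring_1 quat)" "quat_J * quat_J = (- 1 :: 'a quat)"
  "quat_I * quat_J = (quat_K :: 'a quat)" "quat_J * quat_I = (- quat_K :: 'a quat)"
  by (simp_all add: quat_defs quat_I_def quat_J_def quat_K_def)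

lemma quat_decomp:
  "x = quat_of (q1 x) + quat_of (qi x) * quat_I + quat_of (qj x) * quat_J + quat_of (qk x) * quat_K"
  by (simp add: quat_eq_iff quat_defs quat_of_def quat_I_def quat_J_def quat_K_def)

section \<open>The algebra $M_n(F) \otimes_F H$\<close>

text \<open>
  We use the model \<open>M\<^sub>n(H)\<close> of \<open>M\<^sub>n(F) \<otimes>\<^sub>F H\<close>, with pure tensors \<open>Z \<otimes> h = (z\<^sub>i\<^sub>j h)\<^sub>i\<^sub>j\<close>. The
  lemmas below show that this is a tensor product of \<open>F\<close>-algebras.
\<close>

definition tens :: "'a::comm_ring_1 mat \<Rightarrow> 'a quat \<Rightarrow> 'a quat mat" where
  "tens Z h = map_mat (\<lambda>z. quat_of z * h) Z"

text \<open>\<open>f \<otimes> g\<close> for \<open>F\<close>-linear maps \<open>f\<close>, \<open>g\<close>; see \<open>tens_map_tens\<close> below.\<close>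

definition tens_map ::
  "('a::comm_ring_1 mat \<Rightarrow> 'a mat) \<Rightarrow> ('a quat \<Rightarrow> 'a quat) \<Rightarrow> 'a quat mat \<Rightarrow> 'a quat mat" where
  "tens_map f g M =
     tens (f (map_mat q1 M)) (g 1) + tens (f (map_mat qi M)) (g quat_I) +
     tens (f (map_mat qj M)) (g quat_J) + tens (f (map_mat qk M)) (g quat_K)"

text \<open>The structure map \<open>F \<rightarrow> M\<^sub>n(H)\<close>.\<close>

definition quat_scalar :: "nat \<Rightarrow> 'a::comm_ring_1 \<Rightarrow> 'a quat mat" where
  "quat_scalar n c = scalar_mat n (quat_of c)"

text \<open>The adjoint involution $\mathrm{ad}_q$ of a quadratic form with Gram matrix \<open>G\<close>.\<close>

definition ad_involution :: "'f::field mat \<Rightarrow> 'f mat \<Rightarrow> 'f mat" where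
  "ad_involution G Z = G * transpose_mat Z * the (mat_inverse G)"

lemma tens_carrier [simp]: "Z \<in> carrier_mat n n \<Longrightarrow> tens Z h \<in> carrier_mat n n"
  by (simp add: tens_def)

lemma tens_decomp:
  "M = tens (map_mat q1 M) 1 + tens (map_mat qi M) quat_I +
       tens (map_mat qj M) quat_J + tens (map_mat qk M) quat_K"
  by (rule eq_matI) (auto simp: tens_def simp flip: quat_decomp)

lemma tens_bilinear:
  assumes "Z \<in> carrier_mat n n" "Z' \<in> carrier_mat n n"
  shows "tens (Z + Z') h = tens Z h + tens Z' h" "tens Z (h + h') = tens Z h + tens Z h'"
    "tens (c \<cdot>\<^sub>m Z) h = quat_of c \<cdot>\<^sub>m tens Z h" "tens Z (quat_of c * h) = quat_of c \<cdot>\<^sub>m tens Z h"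
  using assms
  by (auto intro!: eq_matI simp: tens_def quat_of_def quat_defs algebra_simps)

lemma quat_of_sum:
  fixes f :: "'i \<Rightarrow> 'a::comm_ring_1"
  shows "quat_of (\<Sum>i\<in>I. f i) = (\<Sum>i\<in>I. quat_of (f i))"
proof -
  have "quat_of 0 = 0" "quat_of (a + b) = quat_of a + quat_of b" for a b :: 'a
    by (simp_all add: quat_of_def quat_defs)
  then show ?thesis
    by (induction I rule: infinite_finite_induct) simp_all
qed

lemma quat_of_mult_shuffle: "quat_of a * h * (quat_of b * h') = quat_of (a * b) * (h * h')"
  by (simp add: quat_of_def quat_defs algebra_simps)

lemma tens_mult:
  assumes "Z \<in> carrier_mat n n" "Z' \<in> carrier_mat n n"
  shows "tens Z h * tens Z' h' = tens (Z * Z') (h * h')"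
  using assms
  by (intro eq_matI)
    (auto simp: tens_def scalar_prod_def quat_of_sum sum_distrib_right quat_of_mult_shuffle)

lemma tens_scalar: "tens (scalar_mat n c) 1 = quat_scalar n c" "tens (1\<^sub>m n) (quat_of c) = quat_scalar n c"
  by (auto intro!: eq_matI simp: tens_def quat_scalar_def scalar_mat_def quat_of_def quat_defs)

lemma tens_map_tens:
  assumes "Z \<in> carrier_mat n n"
    and f: "\<And>Z. Z \<in> carrier_mat n n \<Longrightarrow> f Z \<in> carrier_mat n n"
      "\<And>c Z. Z \<in> carrier_mat n n \<Longrightarrow> f (c \<cdot>\<^sub>m Z) = c \<cdot>\<^sub>m f Z"
    and g: "\<And>x y. g (x + y) = g x + g y" "\<And>c x. g (quat_of c * x) = quat_of c * g x"
  shows "tens_map f g (tens Z h) = tens (f Z) (g h)"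
proof -
  have c: "map_mat q1 (tens Z h) = q1 h \<cdot>\<^sub>m Z" "map_mat qi (tens Z h) = qi h \<cdot>\<^sub>m Z"
    "map_mat qj (tens Z h) = qj h \<cdot>\<^sub>m Z" "map_mat qk (tens Z h) = qk h \<cdot>\<^sub>m Z"
    by (auto intro!: eq_matI simp: tens_def quat_of_def quat_defs mult.commute)
  have "g h = g (quat_of (q1 h) * 1 + quat_of (qi h) * quat_I + quat_of (qj h) * quat_J +
      quat_of (qk h) * quat_K)"
    by (simp only: mult_1_right flip: quat_decomp)
  also have "\<dots> = quat_of (q1 h) * g 1 + quat_of (qi h) * g quat_I + quat_of (qj h) * g quat_J +
      quat_of (qk h) * g quat_K"
    by (simp only: g)
  finally have gh: "g h = \<dots>" .
  show ?thesis
    unfolding tens_map_def c gh f(2)[OF assms(1)]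
    using f(1)[OF assms(1)] by (simp add: tens_bilinear[of _ n])
qed

text \<open>The universal property of the tensor product.\<close>

lemma tens_universal:
  fixes s :: "'f::field \<Rightarrow> 'v::ab_group_add \<Rightarrow> 'v" and \<beta> :: "'f mat \<Rightarrow> 'f quat \<Rightarrow> 'v"
  assumes "vector_space s"
    and b: "\<And>Z Z' h. Z \<in> carrier_mat n n \<Longrightarrow> Z' \<in> carrier_mat n n \<Longrightarrow> \<beta> (Z + Z') h = \<beta> Z h + \<beta> Z' h"
      "\<And>Z h h'. Z \<in> carrier_mat n n \<Longrightarrow> \<beta> Z (h + h') = \<beta> Z h + \<beta> Z h'"
      "\<And>c Z h. Z \<in> carrier_mat n n \<Longrightarrow> \<beta> (c \<cdot>\<^sub>m Z) h = s c (\<beta> Z h)"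
      "\<And>c Z h. Z \<in> carrier_mat n n \<Longrightarrow> \<beta> Z (quat_of c * h) = s c (\<beta> Z h)"
  shows "\<exists>!f. f \<in> extensional (carrier_mat n n) \<and>
    (\<forall>M \<in> carrier_mat n n. \<forall>N \<in> carrier_mat n n. f (M + N) = f M + f N) \<and>
    (\<forall>M \<in> carrier_mat n n. \<forall>c. f (quat_of c \<cdot>\<^sub>m M) = s c (f M)) \<and>
    (\<forall>Z \<in> carrier_mat n n. \<forall>h. f (tens Z h) = \<beta> Z h)"
    (is "\<exists>!f. ?P f")
proof -
  interpret vector_space s by fact
  define f0 where "f0 M = \<beta> (map_mat q1 M) 1 + \<beta> (map_mat qi M) quat_I +
    \<beta> (map_mat qj M) quat_J + \<beta> (map_mat qk M) quat_K" for M
  have map_add: "map_mat q1 (M + N) = map_mat q1 M + map_mat q1 N"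
    "map_mat qi (M + N) = map_mat qi M + map_mat qi N"
    "map_mat qj (M + N) = map_mat qj M + map_mat qj N"
    "map_mat qk (M + N) = map_mat qk M + map_mat qk N"
    if "M \<in> carrier_mat n n" "N \<in> carrier_mat n n" for M N :: "'f quat mat"
    using that by (auto intro!: eq_matI simp: quat_defs)
  have map_smult: "map_mat q1 (quat_of c \<cdot>\<^sub>m M) = c \<cdot>\<^sub>m map_mat q1 M"
    "map_mat qi (quat_of c \<cdot>\<^sub>m M) = c \<cdot>\<^sub>m map_mat qi M"
    "map_mat qj (quat_of c \<cdot>\<^sub>m M) = c \<cdot>\<^sub>m map_mat qj M"
    "map_mat qk (quat_of c \<cdot>\<^sub>m M) = c \<cdot>\<^sub>m map_mat qk M" for c and M :: "'f quat mat"
    by (auto intro!: eq_matI simp: quat_defs quat_of_def)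
  have f0_add: "f0 (M + N) = f0 M + f0 N" if "M \<in> carrier_mat n n" "N \<in> carrier_mat n n" for M N
    using that by (simp add: f0_def map_add b(1) algebra_simps)
  have f0_smult: "f0 (quat_of c \<cdot>\<^sub>m M) = s c (f0 M)" if "M \<in> carrier_mat n n" for M c
    using that by (simp add: f0_def map_smult b(3) scale_right_distrib)
  have f0_tens: "f0 (tens Z h) = \<beta> Z h" if Z: "Z \<in> carrier_mat n n" for Z h
  proof -
    have c: "map_mat q1 (tens Z h) = q1 h \<cdot>\<^sub>m Z" "map_mat qi (tens Z h) = qi h \<cdot>\<^sub>m Z"
      "map_mat qj (tens Z h) = qj h \<cdot>\<^sub>m Z" "map_mat qk (tens Z h) = qk h \<cdot>\<^sub>m Z"
      by (auto intro!: eq_matI simp: tens_def quat_of_def quat_defs mult.commute)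
    have "\<beta> Z h = \<beta> Z (quat_of (q1 h) * 1 + quat_of (qi h) * quat_I + quat_of (qj h) * quat_J +
        quat_of (qk h) * quat_K)"
      by (simp only: mult_1_right flip: quat_decomp)
    also have "\<dots> = f0 (tens Z h)"
      unfolding f0_def c using Z by (simp only: b)
    finally show ?thesis ..
  qed
  have unique: "f M = f0 M" if "?P f" and M: "M \<in> carrier_mat n n" for f M
  proof -
    have "f M = f (tens (map_mat q1 M) 1 + tens (map_mat qi M) quat_I +
        tens (map_mat qj M) quat_J + tens (map_mat qk M) quat_K)"
      by (subst (1) tens_decomp) (rule refl)
    also have "\<dots> = f0 M"
      using that(1) M by (simp add: f0_def)
    finally show ?thesis .
  qed
  show ?thesis
  proof (rule ex1I[of _ "restrict f0 (carrier_mat n n)"])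
    show "?P (restrict f0 (carrier_mat n n))"
      by (simp add: f0_add f0_smult f0_tens)
  next
    fix f assume P: "?P f"
    show "f = restrict f0 (carrier_mat n n)"
      by (rule extensionalityI[of _ "carrier_mat n n"]) (use P unique[OF P] in auto)
  qed
qed

section \<open>The field $F_0(X,Y)$\<close>

type_synonym 'a ratfun2 = "'a poly poly fract"

definition var_X :: "'a::field ratfun2" where
  "var_X = Fract [:[:0, 1:]:] 1"

definition var_Y :: "'a::field ratfun2" where
  "var_Y = Fract [:0, 1:] 1"

text \<open>
  Over \<open>F\<^sub>0(X,Y)\<close> with \<open>F\<^sub>0\<close> formally real, \<open>(-1,-1)\<close> is a division algebra: its norm form
  is anisotropic.
\<close>

definition anisotropic4 :: "'a::idom itself \<Rightarrow> bool" where
  "anisotropic4 _ \<longleftrightarrow> (\<forall>a b c d :: 'a. a * a + b * b + c * c + d * d = 0 \<longrightarrow>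
     a = 0 \<and> b = 0 \<and> c = 0 \<and> d = 0)"

lemma anisotropic4I:
  assumes "\<And>a b c d :: 'a::idom. a * a + b * b + c * c + d * d = 0 \<Longrightarrow> a = 0"
  shows "anisotropic4 TYPE('a)"
  unfolding anisotropic4_def
proof (intro allI impI)
  fix a b c d :: 'a
  assume 0: "a * a + b * b + c * c + d * d = 0"
  show "a = 0 \<and> b = 0 \<and> c = 0 \<and> d = 0"
    using assms[of a b c d] assms[of b a c d] assms[of c a b d] assms[of d a b c] 0
    by (simp add: ac_simps)
qed

lemma formally_real_anisotropic4:
  assumes "formally_real TYPE('a::field)"
  shows "anisotropic4 TYPE('a)"
proof (rule anisotropic4I, rule ccontr)
  fix a b c d :: 'a
  assume 0: "a * a + b * b + c * c + d * d = 0" and a: "a \<noteq> 0"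
  have "- 1 = (\<Sum>x\<leftarrow>[b / a, c / a, d / a]. x\<^sup>2)"
  proof -
    have "(a * a + b * b + c * c + d * d) / (a * a) = 0"
      using 0 by simp
    then have "1 + ((b / a)\<^sup>2 + ((c / a)\<^sup>2 + (d / a)\<^sup>2)) = 0"
      using a by (simp add: add_divide_distrib power2_eq_square add.assoc)
    then show ?thesis
      by (simp add: minus_unique)
  qed
  then show False
    using assms unfolding formally_real_def by blast
qed

lemma coeff_square_double:
  assumes "degree p \<le> n"
  shows "coeff (p * p) (n + n) = coeff p n * coeff p (n :: nat)"
proof (cases "degree p = n")
  case True
  then show ?thesis
    using coeff_mult_degree_sum[of p p] by simp
next
  case False
  then have "degree p < n"
    using assms by simp
  moreover from this have "degree (p * p) < n + n"
    using degree_mult_le[of p p] by linarith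
  ultimately show ?thesis
    by (simp add: coeff_eq_0)
qed

lemma anisotropic4_poly:
  assumes "anisotropic4 TYPE('a::idom)"
  shows "anisotropic4 TYPE('a poly)"
proof (rule anisotropic4I)
  fix a b c d :: "'a poly"
  assume 0: "a * a + b * b + c * c + d * d = 0"
  define n where "n = Max {degree a, degree b, degree c, degree d}"
  have leq: "degree a \<le> n" "degree b \<le> n" "degree c \<le> n" "degree d \<le> n"
    by (simp_all add: n_def)
  have "coeff (a * a + b * b + c * c + d * d) (n + n) = 0"
    using 0 by simp
  then have "coeff a n * coeff a n + coeff b n * coeff b n + coeff c n * coeff c n +
      coeff d n * coeff d n = 0"
    by (simp add: coeff_square_double leq)
  then have z: "coeff a n = 0 \<and> coeff b n = 0 \<and> coeff c n = 0 \<and> coeff d n = 0"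
    using assms unfolding anisotropic4_def by blast
  have "n \<in> {degree a, degree b, degree c, degree d}"
    unfolding n_def by (rule Max_in) auto
  then have "n = 0"
    using z by auto
  then show "a = 0"
    using z leq by (metis le_zero_eq leading_coeff_0_iff)
qed

lemma anisotropic4_fract:
  assumes "anisotropic4 TYPE('a::idom)"
  shows "anisotropic4 TYPE('a fract)"
proof (rule anisotropic4I)
  fix a b c d :: "'a fract"
  assume 0: "a * a + b * b + c * c + d * d = 0"
  obtain a1 a2 where a: "a = Fract a1 a2" "a2 \<noteq> 0" by (cases a)
  obtain b1 b2 where b: "b = Fract b1 b2" "b2 \<noteq> 0" by (cases b)
  obtain c1 c2 where c: "c = Fract c1 c2" "c2 \<noteq> 0" by (cases c)
  obtain d1 d2 where d: "d = Fract d1 d2" "d2 \<noteq> 0" by (cases d)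
  let ?D = "Fract (a2 * b2 * c2 * d2) 1"
  let ?a = "a1 * b2 * c2 * d2" and ?b = "b1 * a2 * c2 * d2"
    and ?c = "c1 * a2 * b2 * d2" and ?d = "d1 * a2 * b2 * c2"
  have "a * ?D = Fract ?a 1" "b * ?D = Fract ?b 1" "c * ?D = Fract ?c 1" "d * ?D = Fract ?d 1"
    using a b c d by (simp_all add: eq_fract)
  moreover have "(a * ?D) * (a * ?D) + (b * ?D) * (b * ?D) + (c * ?D) * (c * ?D) +
      (d * ?D) * (d * ?D) = (a * a + b * b + c * c + d * d) * (?D * ?D)"
    by (simp only: distrib_left distrib_right ac_simps)
  ultimately have "Fract (?a * ?a + ?b * ?b + ?c * ?c + ?d * ?d) 1 = 0"
    using 0 by simp
  then have "?a * ?a + ?b * ?b + ?c * ?c + ?d * ?d = 0"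
    by (simp add: Zero_fract_def eq_fract)
  then have "?a = 0"
    using assms unfolding anisotropic4_def by blast
  then show "a = 0"
    using a b c d by (simp add: Zero_fract_def eq_fract)
qed

lemma quat_norm:
  fixes x :: "'a::comm_ring_1 quat"
  shows "x * quat_conj x = quat_of (q1 x * q1 x + qi x * qi x + qj x * qj x + qk x * qk x)"
    and "quat_conj x * x = quat_of (q1 x * q1 x + qi x * qi x + qj x * qj x + qk x * qk x)"
  by (simp_all add: quat_defs quat_conj_def quat_of_def algebra_simps)

lemma quat_of_central: "x * (quat_of c * y) = quat_of c * (x * y)"
  by (simp add: quat_defs quat_of_def algebra_simps)

lemma quat_of_mult: "quat_of a * quat_of b = quat_of (a * b)" and quat_of_1: "quat_of 1 = 1"
  by (simp_all add: quat_defs quat_of_def)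

lemma quat_division:
  assumes "formally_real TYPE('a::field)" and "(x :: 'a ratfun2 quat) \<noteq> 0"
  shows "\<exists>y. x * y = 1 \<and> y * x = 1"
proof -
  define N where "N = q1 x * q1 x + qi x * qi x + qj x * qj x + qk x * qk x"
  have an: "anisotropic4 TYPE('a ratfun2)"
    using assms(1) by (intro anisotropic4_fract anisotropic4_poly formally_real_anisotropic4)
  have N: "N \<noteq> 0"
  proof
    assume "N = 0"
    then have "q1 x = 0 \<and> qi x = 0 \<and> qj x = 0 \<and> qk x = 0"
      using an unfolding anisotropic4_def N_def by blast
    then show False
      using assms(2) by (simp only: quat_eq_iff zero_quat_def quat.sel simp_thms)
  qed
  let ?c = "quat_of (inverse N)"
  note norm = quat_norm[of x, folded N_def]
  have inv: "?c * quat_of N = 1"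
    by (simp only: quat_of_mult left_inverse[OF N] quat_of_1)
  have "x * (?c * quat_conj x) = 1"
    by (simp only: quat_of_central norm inv)
  moreover have "(?c * quat_conj x) * x = 1"
    by (simp only: mult.assoc norm inv)
  ultimately have "x * (?c * quat_conj x) = 1 \<and> (?c * quat_conj x) * x = 1" ..
  then show ?thesis by blast
qed

section \<open>The algebra with involution\<close>

abbreviation alg_A :: "'a::field ratfun2 quat mat ring" where
  "alg_A \<equiv> mat_alg TYPE('a ratfun2 quat) 3"

abbreviation emb_A :: "'a::field ratfun2 \<Rightarrow> 'a ratfun2 quat mat" where
  "emb_A \<equiv> quat_scalar 3"

definition gram_q :: "'a::field ratfun2 mat" where
  "gram_q = mat_diag 3 (\<lambda>i. [var_X, var_Y, var_X * var_Y] ! i)"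

definition sigma_A :: "'a::field ratfun2 quat mat \<Rightarrow> 'a ratfun2 quat mat" where
  "sigma_A = tens_map (ad_involution gram_q) quat_conj"

end

theory Submission
  imports Defs
begin

text \<open>
  Let \<open>g\<^sub>1, g\<^sub>2, g\<^sub>3\<close> be the diagonal entries \<open>X, Y, XY\<close> of \<open>q\<close> and \<open>N\<close> the norm form of \<open>H\<close>. The
  \<open>a\<close>-th diagonal entry of \<open>\<sigma>(x) x\<close> is the sum over \<open>l\<close> of \<open>(g\<^sub>a / g\<^sub>l) N(x\<^sub>l\<^sub>a)\<close>, and the reduced trace of a
  matrix is twice the sum of the scalar parts of its diagonal entries. Hence \<open>g\<^sub>1 / g\<^sub>2 = X / Y\<close> is
  nonnegative for every \<open>\<sigma>\<close>-ordering, and so is \<open>XY\<close>. If \<open>XY\<close> were a sum of hermitian squares, the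
  last diagonal entry would give \<open>1 = X s + Y t + XY u\<close> with sums of squares \<open>s, t, u\<close> in \<open>F\<close>.
  Leading terms of squares do not cancel over the formally real \<open>F\<^sub>0\<close>, so after clearing denominators
  the bidegrees of the four terms differ modulo 2 and the equation is impossible.
\<close>

section \<open>Sums of squares in rational function fields\<close>

text \<open>The coefficients \<open>1\<close>, \<open>X\<close>, \<open>Y\<close>, \<open>XY\<close>
  represent the four classes of exponent pairs modulo 2, so multiplying them by elements with even
  leading exponents cannot make the terms cancel. Sums of squares of \<open>F\<close> are hard to
  control directly. They are replaced by a larger set described by leading terms alone: even leading
  exponents and a leading coefficient that is a nonzero sum of squares in \<open>F_0\<close>. This
  set passes from a ring to polynomials in one more variable and to the fraction field, and no
  ordering of \<open>F\<close> has to be constructed. On the matrix side the difficulty is that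
  \<open>Trd\<close> is a definite description over all splittings of every size. Its value needs
  one explicit splitting as well as a computation valid in an arbitrary one. The same kind of
  explicit splitting also carries the alternating form that makes \<open>\<sigma>\<close>
  symplectic. Since \<open>XY\<close> is central, it only scales \<open>Trd\<close> of
  \<open>\<sigma> x * x\<close>, so its positivity in \<open>F\<close> is all that matters.\<close>

definition precone :: "'a::idom set \<Rightarrow> bool" where
  "precone P \<longleftrightarrow> 0 \<notin> P \<and> 1 \<in> P \<and> (\<forall>x\<in>P. \<forall>y\<in>P. x + y \<in> P) \<and> (\<forall>x\<in>P. \<forall>y. y \<noteq> 0 \<longrightarrow> y * y * x \<in> P)"

text \<open>The leading term of a square is a square, hence the even degree. For a precone
  \<open>P\<close> the zero polynomial is excluded automatically, its leading coefficient being
  0.\<close>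

definition poly_precone :: "'a::idom set \<Rightarrow> 'a poly set" where
  "poly_precone P = {p. even (degree p) \<and> lead_coeff p \<in> P}"

text \<open>The quotient \<open>a / b\<close> is \<open>a * b\<close> times the square of
  \<open>1 / b\<close>, so \<open>a * b\<close> decides membership. Asking only for some
  representation avoids a normal form of fractions.\<close>

definition fract_precone :: "'a::idom set \<Rightarrow> 'a fract set" where
  "fract_precone P = {Fract a b | a b. b \<noteq> 0 \<and> a * b \<in> P}"

lemma precone_square: "precone P \<Longrightarrow> x \<noteq> 0 \<Longrightarrow> x * x \<in> P"
  unfolding precone_def by (metis mult.right_neutral)

lemma precone_square0: "precone P \<Longrightarrow> x * x \<in> insert 0 P"
  using precone_square by fastforce

lemma precone_add0: "precone P \<Longrightarrow> x \<in> insert 0 P \<Longrightarrow> y \<in> insert 0 P \<Longrightarrow> x + y \<in> insert 0 P"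
  by (auto simp: precone_def)

lemma precone_mult_square0: "precone P \<Longrightarrow> x \<in> insert 0 P \<Longrightarrow> y * y * x \<in> insert 0 P"
  by (auto simp: precone_def)

lemma precone_sum0:
  assumes "precone P" "\<And>i. i \<in> I \<Longrightarrow> f i \<in> insert 0 P"
  shows "sum f I \<in> insert 0 P"
  using assms(2) by (induction I rule: infinite_finite_induct) (simp, simp, metis precone_add0[OF assms(1)] insertI1 insertI2 sum.insert)

text \<open>A vanishing sum of squares with a nonzero term \<open>x * x\<close> would, after
  division by that term, write \<open>-1\<close> as a sum of squares. Hence nonzero sums of squares
  never add up to 0.\<close>

lemma formally_real_precone:
  assumes "formally_real TYPE('a::field)"
  shows "precone {x :: 'a. \<exists>xs. x = (\<Sum>y\<leftarrow>xs. y\<^sup>2) \<and> x \<noteq> 0}"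
proof -
  have no0: "x = 0 \<and> (\<Sum>y\<leftarrow>xs. y\<^sup>2) = 0" if "x\<^sup>2 + (\<Sum>y\<leftarrow>xs. y\<^sup>2) = 0" for x :: 'a and xs
  proof -
    have "x = 0"
    proof (rule ccontr)
      assume x: "x \<noteq> 0"
      have "(\<Sum>y\<leftarrow>map (\<lambda>y. y / x) xs. y\<^sup>2) = (\<Sum>y\<leftarrow>xs. y\<^sup>2) / x\<^sup>2"
        by (induction xs) (simp_all add: power_divide add_divide_distrib)
      also have "(\<Sum>y\<leftarrow>xs. y\<^sup>2) = - (x\<^sup>2)"
        using that by (simp add: eq_neg_iff_add_eq_0 add.commute)
      finally show False
        using assms x unfolding formally_real_def by (metis divide_self_if minus_divide_left zero_eq_power2)
    qed
    then show ?thesis using that by simp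
  qed
  have sum0: "(\<Sum>y\<leftarrow>xs. y\<^sup>2) + (\<Sum>y\<leftarrow>ys. y\<^sup>2) = 0 \<Longrightarrow> (\<Sum>y\<leftarrow>xs. y\<^sup>2) = 0" for xs ys :: "'a list"
  proof (induction xs)
    case (Cons x xs)
    then show ?case using no0[of x "xs @ ys"] by (simp add: add.assoc)
  qed simp
  show ?thesis
    unfolding precone_def
  proof (intro conjI ballI allI impI)
    show "1 \<in> {x :: 'a. \<exists>xs. x = (\<Sum>y\<leftarrow>xs. y\<^sup>2) \<and> x \<noteq> 0}"
      by (auto intro: exI[of _ "[1]"])
  next
    fix x y :: 'a
    assume "x \<in> {x. \<exists>xs. x = (\<Sum>y\<leftarrow>xs. y\<^sup>2) \<and> x \<noteq> 0}" "y \<in> {x. \<exists>xs. x = (\<Sum>y\<leftarrow>xs. y\<^sup>2) \<and> x \<noteq> 0}"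
    then obtain xs ys where xy: "x = (\<Sum>y\<leftarrow>xs. y\<^sup>2)" "y = (\<Sum>y\<leftarrow>ys. y\<^sup>2)" "x \<noteq> 0" by blast
    then have "x + y = (\<Sum>y\<leftarrow>xs @ ys. y\<^sup>2)" "x + y \<noteq> 0" using sum0[of xs ys] by auto
    then show "x + y \<in> {x. \<exists>xs. x = (\<Sum>y\<leftarrow>xs. y\<^sup>2) \<and> x \<noteq> 0}" by blast
  next
    fix x y :: 'a
    assume "x \<in> {x. \<exists>xs. x = (\<Sum>y\<leftarrow>xs. y\<^sup>2) \<and> x \<noteq> 0}" and y: "y \<noteq> 0"
    then obtain xs where x: "x = (\<Sum>y\<leftarrow>xs. y\<^sup>2)" "x \<noteq> 0" by blast
    have "y * y * (\<Sum>y\<leftarrow>xs. y\<^sup>2) = (\<Sum>y\<leftarrow>map ((*) y) xs. y\<^sup>2)"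
      by (induction xs) (simp_all add: algebra_simps power2_eq_square)
    then show "y * y * x \<in> {x. \<exists>xs. x = (\<Sum>y\<leftarrow>xs. y\<^sup>2) \<and> x \<noteq> 0}"
      using x y by (metis (mono_tags, lifting) mem_Collect_eq mult_eq_0_iff)
  qed auto
qed

lemma precone_poly_precone:
  assumes "precone P"
  shows "precone (poly_precone P)"
  unfolding precone_def
proof (intro conjI ballI allI impI)
  fix p q assume pq: "p \<in> poly_precone P" "q \<in> poly_precone P"
  consider "degree p < degree q" | "degree q < degree p" | "degree p = degree q" by linarith
  then show "p + q \<in> poly_precone P"
  proof cases
    case 3
    \<comment> \<open>For equal degrees the two leading coefficients add up inside \<open>P\<close>,
      hence to something nonzero, and the degree of the sum does not drop.\<close>
    have "coeff (p + q) (degree q) \<in> P"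
      using pq 3 assms by (auto simp: poly_precone_def precone_def)
    moreover from this have "degree (p + q) = degree q"
      using assms 3 degree_add_le[of p "degree q" q] le_degree[of "p + q" "degree q"]
      unfolding precone_def by (metis order.antisym order.refl)
    ultimately show ?thesis using pq by (simp add: poly_precone_def)
  qed (use pq in \<open>auto simp: poly_precone_def degree_add_eq_right degree_add_eq_left coeff_eq_0\<close>)
next
  fix p q :: "'a poly" assume p: "p \<in> poly_precone P" and q: "q \<noteq> 0"
  moreover have "p \<noteq> 0" using p assms by (auto simp: poly_precone_def precone_def)
  moreover have "lead_coeff (q * q * p) \<in> P"
    using p q assms unfolding lead_coeff_mult by (auto simp: poly_precone_def precone_def)
  ultimately show "q * q * p \<in> poly_precone P"
    using q by (auto simp: poly_precone_def degree_mult_eq)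
qed (use assms in \<open>auto simp: precone_def poly_precone_def\<close>)


lemma precone_fract_precone:
  assumes "precone P"
  shows "precone (fract_precone P)"
  unfolding precone_def
proof (intro conjI ballI allI impI)
  show "0 \<notin> fract_precone P"
    using assms by (auto simp: precone_def fract_precone_def Zero_fract_def eq_fract)
  show "1 \<in> fract_precone P"
    using assms by (auto simp: fract_precone_def One_fract_def precone_def intro!: exI[of _ 1])
next
  fix x y assume "x \<in> fract_precone P" "y \<in> fract_precone P"
  then obtain a b c d where xy: "x = Fract a b" "y = Fract c d" "b \<noteq> 0" "d \<noteq> 0" "a * b \<in> P" "c * d \<in> P"
    by (auto simp: fract_precone_def)
  \<comment> \<open>Over the common denominator \<open>b * d\<close>, numerator times denominator of
    the sum is a combination of \<open>a * b\<close> and \<open>c * d\<close> with square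
    coefficients.\<close>
  have "d * d * (a * b) + b * b * (c * d) \<in> P"
    using xy assms unfolding precone_def by blast
  moreover have "d * d * (a * b) + b * b * (c * d) = (a * d + c * b) * (b * d)"
    by (simp add: algebra_simps)
  ultimately show "x + y \<in> fract_precone P"
    unfolding fract_precone_def mem_Collect_eq using xy
    by (intro exI[where x = "a * d + c * b"] exI[where x = "b * d"]) simp
next
  fix x y :: "'a fract" assume "x \<in> fract_precone P" and y: "y \<noteq> 0"
  then obtain a b where x: "x = Fract a b" "b \<noteq> 0" "a * b \<in> P" by (auto simp: fract_precone_def)
  obtain c d where cd: "y = Fract c d" "d \<noteq> 0" by (cases y)
  then have "c \<noteq> 0" using y by (auto simp: Zero_fract_def eq_fract)
  then have "(c * d) * (c * d) * (a * b) \<in> P"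
    using x cd assms unfolding precone_def by (metis mult_eq_0_iff)
  moreover have "(c * d) * (c * d) * (a * b) = (c * c * a) * (d * d * b)"
    by (simp add: algebra_simps)
  ultimately show "y * y * x \<in> fract_precone P"
    unfolding fract_precone_def mem_Collect_eq using x cd
    by (intro exI[where x = "c * c * a"] exI[where x = "d * d * b"]) (simp add: ac_simps)
qed

section \<open>Clearing square denominators and the parity of degrees\<close>

lemma fract_precone_clear:
  assumes "x \<in> insert 0 (fract_precone P)"
  shows "\<exists>d a. d \<noteq> 0 \<and> a \<in> insert 0 P \<and> Fract (d * d) 1 * x = Fract a 1"
proof (cases "x = 0")
  case True
  then show ?thesis by (intro exI[of _ 1] exI[of _ 0]) (simp add: Zero_fract_def)
next
  case False
  then obtain a b where "x = Fract a b" "b \<noteq> 0" "a * b \<in> P"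
    using assms by (auto simp: fract_precone_def)
  then show ?thesis by (intro exI[of _ b] exI[of _ "a * b"]) (simp add: eq_fract)
qed

text \<open>Multiplication by \<open>c\<close> times the variable raises the degree by one, but both
  degrees are even. This supplies the non-cancellation hypothesis of
  \<open>poly_precone_diff_degree\<close> for the coefficients \<open>X\<close> and
  \<open>- X\<close>.\<close>

lemma poly_precone_odd_shift:
  assumes "a \<in> insert 0 (poly_precone P)" "b \<in> insert 0 (poly_precone P)"
    and "a = [:0, c:] * b" "c \<noteq> 0"
  shows "b = 0"
proof (rule ccontr)
  assume b: "b \<noteq> 0"
  then have "degree a = Suc (degree b)" using assms by (simp add: degree_mult_eq)
  moreover have "even (degree a)" "even (degree b)" using assms(1,2) by (auto simp: poly_precone_def)
  ultimately show False by simp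
qed

text \<open>By the assumption on \<open>c\<close>, one element of \<open>insert 0 P\<close> is
  \<open>c\<close> times another only if both vanish, so the top coefficients of \<open>a\<close>
  and \<open>[:c:] * b\<close> cannot cancel. A nonzero difference therefore has the larger of the
  two degrees, which is even.\<close>

lemma poly_precone_diff_degree:
  assumes P: "precone P" and a: "a \<in> insert 0 (poly_precone P)" and b: "b \<in> insert 0 (poly_precone P)"
    and c: "\<And>u v. u \<in> insert 0 P \<Longrightarrow> v \<in> insert 0 P \<Longrightarrow> u = c * v \<Longrightarrow> v = 0"
  shows "even (degree (a - [:c:] * b)) \<and> (a - [:c:] * b = 0 \<longrightarrow> a = 0 \<and> b = 0)"
proof -
  define n where "n = max (degree a) (degree b)"
  have ev: "even n" using a b by (auto simp: n_def poly_precone_def max_def)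
  have coeff0: "coeff p n \<in> insert 0 P" if "p \<in> {a, b}" for p
  proof (cases "degree p = n")
    case True
    then show ?thesis using that a b by (auto simp: poly_precone_def)
  next
    case False
    then have "degree p < n" using that by (auto simp: n_def max_def split: if_splits)
    then show ?thesis by (simp add: coeff_eq_0)
  qed
  have cf: "coeff (a - [:c:] * b) n = coeff a n - c * coeff b n" by simp
  show ?thesis
  proof (cases "coeff (a - [:c:] * b) n = 0")
    case True
    then have "coeff b n = 0" using c[OF coeff0 coeff0, of a b] cf by simp
    moreover from this have "coeff a n = 0" using True cf by simp
    moreover have "degree a = n \<or> degree b = n" by (auto simp: n_def max_def)
    \<comment> \<open>A polynomial of degree \<open>n\<close> whose coefficient at \<open>n\<close>
      vanishes is zero. This forces \<open>n = 0\<close>, so both polynomials are constant.\<close>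
    ultimately have "a = 0 \<and> degree a = n \<or> b = 0 \<and> degree b = n" by auto
    then have "n = 0" by auto
    moreover from this have "degree a = 0" "degree b = 0" by (auto simp: n_def)
    ultimately have "a = 0 \<and> b = 0" using \<open>coeff a n = 0\<close> \<open>coeff b n = 0\<close>
      by (metis leading_coeff_0_iff)
    then show ?thesis by simp
  next
    case False
    have "degree (a - [:c:] * b) \<le> n"
      by (rule degree_diff_le) (auto simp: n_def intro: order.trans[OF degree_smult_le])
    moreover have "n \<le> degree (a - [:c:] * b)" by (rule le_degree) fact
    ultimately have "degree (a - [:c:] * b) = n" by simp
    then show ?thesis using ev False by auto
  qed
qed

text \<open>The four terms of the form have degrees of pairwise different parity in the two
  variables, so that no cancellation between them is possible.\<close>

lemma one_not_represented:
  assumes "formally_real TYPE('a::field)"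
  shows "\<exists>P :: 'a ratfun2 set. precone P \<and>
    (\<forall>s\<in>insert 0 P. \<forall>t\<in>insert 0 P. \<forall>u\<in>insert 0 P. var_X * s + var_Y * t + var_X * var_Y * u \<noteq> 1)"
proof -
  obtain P0 :: "'a set" where P0: "precone P0" using formally_real_precone[OF assms] by blast
  define P1 where "P1 = poly_precone P0"
  define P2 where "P2 = poly_precone P1"
  have P1: "precone P1" and P2: "precone P2" and P3: "precone (fract_precone P2)"
    using P0 by (simp_all add: P1_def P2_def precone_poly_precone precone_fract_precone)
  have "var_X * s + var_Y * t + var_X * var_Y * u \<noteq> 1"
    if stu: "s \<in> insert 0 (fract_precone P2)" "t \<in> insert 0 (fract_precone P2)" "u \<in> insert 0 (fract_precone P2)" for s t u
  proof
    assume eq: "var_X * s + var_Y * t + var_X * var_Y * u = 1"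
    obtain ds s' where s': "ds \<noteq> 0" "s' \<in> insert 0 P2" "Fract (ds * ds) 1 * s = Fract s' 1"
      using fract_precone_clear[OF stu(1)] by blast
    obtain dt t' where t': "dt \<noteq> 0" "t' \<in> insert 0 P2" "Fract (dt * dt) 1 * t = Fract t' 1"
      using fract_precone_clear[OF stu(2)] by blast
    obtain du u' where u': "du \<noteq> 0" "u' \<in> insert 0 P2" "Fract (du * du) 1 * u = Fract u' 1"
      using fract_precone_clear[OF stu(3)] by blast
    \<comment> \<open>Multiplying by the square of the common \<open>d\<close> leaves, for each
      summand, the squares of the other two denominators; these are absorbed without leaving the
      precone.\<close>
    define d where "d = ds * dt * du"
    define S where "S = (dt * du) * (dt * du) * s'"
    define T where "T = (ds * du) * (ds * du) * t'"
    define U where "U = (ds * dt) * (ds * dt) * u'"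
    have STU: "S \<in> insert 0 P2" "T \<in> insert 0 P2" "U \<in> insert 0 P2" "d * d \<in> insert 0 P2"
      unfolding S_def T_def U_def
      by (intro precone_mult_square0 precone_square0 P2 s' t' u')+
    have S: "Fract (d * d) 1 * s = Fract S 1"
    proof -
      have "Fract (d * d) 1 * s = Fract ((dt * du) * (dt * du)) 1 * (Fract (ds * ds) 1 * s)"
        by (simp add: d_def mult.assoc [symmetric]) (simp add: mult_ac)
      then show ?thesis by (simp add: s' S_def)
    qed
    have T: "Fract (d * d) 1 * t = Fract T 1"
    proof -
      have "Fract (d * d) 1 * t = Fract ((ds * du) * (ds * du)) 1 * (Fract (dt * dt) 1 * t)"
        by (simp add: d_def mult.assoc [symmetric]) (simp add: mult_ac)
      then show ?thesis by (simp add: t' T_def)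
    qed
    have U: "Fract (d * d) 1 * u = Fract U 1"
    proof -
      have "Fract (d * d) 1 * u = Fract ((ds * dt) * (ds * dt)) 1 * (Fract (du * du) 1 * u)"
        by (simp add: d_def mult.assoc [symmetric]) (simp add: mult_ac)
      then show ?thesis by (simp add: u' U_def)
    qed
    have "Fract (d * d) 1 = Fract (d * d) 1 * (var_X * s + var_Y * t + var_X * var_Y * u)"
      by (simp only: eq mult_1_right)
    also have "\<dots> = var_X * (Fract (d * d) 1 * s) + var_Y * (Fract (d * d) 1 * t) + var_X * var_Y * (Fract (d * d) 1 * u)"
      by (simp only: distrib_left ac_simps)
    also have "\<dots> = Fract ([:[:0, 1:]:] * S + [:0, 1:] * T + [:[:0, 1:]:] * [:0, 1:] * U) 1"
      unfolding S T U var_X_def var_Y_def by simp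
    finally have "d * d = [:[:0, 1:]:] * S + [:0, 1:] * T + [:[:0, 1:]:] * [:0, 1:] * U"
      by (simp add: eq_fract)
    \<comment> \<open>Terms with the factor \<open>Y\<close> are separated from those without it.
      Writing \<open>T + X * U\<close> as \<open>T - (- X) * U\<close> gives both brackets the shape
      \<open>a - [:c:] * b\<close>, with \<open>c = X\<close> and \<open>c = - X\<close>.\<close>
    moreover have "D - x * S = y * (T - (- x) * U)" if "D = x * S + y * T + x * y * U"
      for D x y :: "'a poly poly"
      using that by (simp add: algebra_simps)
    moreover have "- [:[:0, 1:]:] = [:- [:0, 1 :: 'a:]:]" by simp
    ultimately have e: "d * d - [:[:0, 1:]:] * S = [:0, 1:] * (T - [:- [:0, 1:]:] * U)"
      by metis
    have 1: "even (degree (d * d - [:[:0, 1:]:] * S)) \<and> (d * d - [:[:0, 1:]:] * S = 0 \<longrightarrow> d * d = 0 \<and> S = 0)"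
      using P1 STU(4,1)[unfolded P2_def] by (rule poly_precone_diff_degree)
        (unfold P1_def, erule (2) poly_precone_odd_shift, simp)
    have 2: "even (degree (T - [:- [:0, 1:]:] * U)) \<and> (T - [:- [:0, 1:]:] * U = 0 \<longrightarrow> T = 0 \<and> U = 0)"
      using P1 STU(2,3)[unfolded P2_def] by (rule poly_precone_diff_degree)
        (unfold P1_def, rule poly_precone_odd_shift[where c = "- 1"], assumption+, simp_all)
    \<comment> \<open>Otherwise the factor \<open>Y\<close> makes the \<open>Y\<close>-degree of the
      right-hand side odd, while that of the left-hand side is even.\<close>
    have "T - [:- [:0, 1:]:] * U = 0"
    proof (rule ccontr)
      assume "T - [:- [:0, 1:]:] * U \<noteq> 0"
      then have "degree (d * d - [:[:0, 1:]:] * S) = Suc (degree (T - [:- [:0, 1:]:] * U))"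
        unfolding e by (subst degree_mult_eq) auto
      then show False using 1 2 by simp
    qed
    then have "d * d = 0" using e 1 by simp
    then show False using s' t' u' by (simp add: d_def)
  qed
  then show ?thesis using P3 by blast
qed

section \<open>Matrix algebras over a ring\<close>

lemma ring_mat_ring: "ring (ring_mat TYPE('r::ring_1) n b)"
proof -
  interpret semiring "ring_mat TYPE('r) n b" by (rule semiring_mat)
  have "\<exists>y\<in>carrier_mat n n. y + x = 0\<^sub>m n n" if "x \<in> carrier_mat n n" for x :: "'r mat"
    using that by (intro bexI[of _ "- x"]) auto
  then have "abelian_group (ring_mat TYPE('r) n b)"
    by (intro abelian_groupI) (auto simp: ring_mat_simps intro: comm_add_mat)
  then show ?thesis
    by (intro ringI monoid_axioms) (simp_all add: l_distr r_distr)
qed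

lemma scalar_mat_carrier [simp]: "scalar_mat n c \<in> carrier_mat n n"
  by (simp add: scalar_mat_def)

lemma scalar_mat_one: "scalar_mat n 1 = 1\<^sub>m n"
  by (intro eq_matI) (auto simp: scalar_mat_def)

lemma scalar_mat_mult:
  fixes c :: "'r::ring_1"
  assumes "M \<in> carrier_mat n n"
  shows "scalar_mat n c * M = c \<cdot>\<^sub>m M"
proof -
  have "(\<Sum>l<n. c * (if l = i then 1 else 0) * M $$ (l, j)) = c * M $$ (i, j)" if "i < n" for i j
    using that by (subst sum.remove[of _ i]) auto
  then show ?thesis
  using assms by (intro eq_matI) (auto simp: scalar_mat_def scalar_prod_def atLeast0LessThan)
qed

lemma mult_scalar_mat:
  fixes c :: "'r::ring_1"
  assumes "M \<in> carrier_mat n n"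
  shows "M * scalar_mat n c = map_mat (\<lambda>x. x * c) M"
proof -
  have "(\<Sum>l<n. M $$ (i, l) * (c * (if l = j then 1 else 0))) = M $$ (i, j) * c" if "j < n" for i j
    using that by (subst sum.remove[of _ j]) auto
  then show ?thesis
    using assms by (intro eq_matI) (auto simp: scalar_mat_def scalar_prod_def atLeast0LessThan)
qed

text \<open>Covers the two algebras to be compared: \<open>M_n(L)\<close> over \<open>L\<close>,
  with \<open>g\<close> the identity, and \<open>M_n(H)\<close> over \<open>F\<close>, with
  \<open>g = quat_of\<close>.\<close>

locale central_scalars =
  fixes g :: "'f::field \<Rightarrow> 'r::ring_1"
  assumes g_add: "g (x + y) = g x + g y"
    and g_mult: "g (x * y) = g x * g y"
    and g_one: "g 1 = 1"
    and g_central: "g c * r = r * g c"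
begin

lemma g_zero: "g 0 = 0"
  using g_add[of 0 0] by simp

lemma field_algebra_mat: "field_algebra (\<lambda>c. scalar_mat n (g c)) (mat_alg TYPE('r) n)"
  unfolding field_algebra_def ring_mat_simps
proof (intro conjI allI ballI ring_hom_memI; (unfold ring_mat_simps)?)
  fix x y :: 'f
  show "scalar_mat n (g (x \<otimes>\<^bsub>ring_of_type_algebra\<^esub> y)) = scalar_mat n (g x) * scalar_mat n (g y)"
    by (subst scalar_mat_mult) (auto simp: ring_of_type_algebra_def g_mult scalar_mat_def)
  show "scalar_mat n (g (x \<oplus>\<^bsub>ring_of_type_algebra\<^esub> y)) = scalar_mat n (g x) + scalar_mat n (g y)"
    by (auto simp: ring_of_type_algebra_def g_add scalar_mat_def algebra_simps)
  show "scalar_mat n (g \<one>\<^bsub>ring_of_type_algebra\<^esub>) = 1\<^sub>m n"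
    by (auto simp: ring_of_type_algebra_def g_one scalar_mat_def)
next
  fix c and x :: "'r mat" assume "x \<in> carrier_mat n n"
  then show "scalar_mat n (g c) * x = x * scalar_mat n (g c)"
    by (auto simp: scalar_mat_mult mult_scalar_mat g_central)
qed (auto intro: ring_mat_ring)

lemma subfield_scalars:
  assumes "n > 0"
  shows "subfield (range (\<lambda>c. scalar_mat n (g c))) (mat_alg TYPE('r) n)"
proof -
  interpret F: field "ring_of_type_algebra :: 'f ring" by (rule field_from_type_algebra)
  interpret h: ring_hom_ring "ring_of_type_algebra :: 'f ring" "mat_alg TYPE('r) n" "\<lambda>c. scalar_mat n (g c)"
    using field_algebra_mat[of n] by (intro ring_hom_ringI2 F.ring_axioms) (auto simp: field_algebra_def)
  have "(1\<^sub>m n :: 'r mat) $$ (0, 0) \<noteq> 0\<^sub>m n n $$ (0, 0)"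
    using assms by simp
  then have "\<one>\<^bsub>mat_alg TYPE('r) n\<^esub> \<noteq> \<zero>\<^bsub>mat_alg TYPE('r) n\<^esub>"
    unfolding ring_mat_simps by metis
  from h.img_is_subfield(2)[OF F.carrier_is_subfield this] show ?thesis
    by (simp add: ring_of_type_algebra_def)
qed

lemma combine_scalar_mat:
  assumes "\<And>x. x \<in> set xs \<Longrightarrow> B x \<in> carrier_mat n n"
  shows "ring.combine (mat_alg TYPE('r) n) (map (\<lambda>x. scalar_mat n (g (k x))) xs) (map B xs) =
    mat n n (\<lambda>(i, j). \<Sum>x\<leftarrow>xs. g (k x) * B x $$ (i, j))"
proof -
  interpret A: ring "mat_alg TYPE('r) n" by (rule ring_mat_ring)
  show ?thesis
    using assms
  proof (induction xs)
    case (Cons x xs)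
    then have Bx: "B x \<in> carrier_mat n n" by simp
    then have "(c \<cdot>\<^sub>m B x) $$ (i, j) = c * B x $$ (i, j)" if "i < n" "j < n" for c i j
      using that by simp
    with Bx Cons show ?case by (auto simp: ring_mat_simps scalar_mat_mult intro!: eq_matI)
  qed (auto simp: ring_mat_simps)
qed

text \<open>Bridges the list-based notions of span and independence and entrywise sums over an index
  set. Distinct indices allow a list of coefficients to be read as a function.\<close>

lemma algebra_basis_mat:
  assumes n: "n > 0" and d: "distinct xs" and B: "\<And>x. x \<in> set xs \<Longrightarrow> B x \<in> carrier_mat n n"
    and span: "\<And>M. M \<in> carrier_mat n n \<Longrightarrow>
      \<exists>k. \<forall>i<n. \<forall>j<n. M $$ (i, j) = (\<Sum>x\<in>set xs. g (k x) * B x $$ (i, j))"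
    and indep: "\<And>k. (\<And>i j. i < n \<Longrightarrow> j < n \<Longrightarrow> (\<Sum>x\<in>set xs. g (k x) * B x $$ (i, j)) = 0) \<Longrightarrow>
      \<forall>x\<in>set xs. k x = 0"
  shows "algebra_basis (\<lambda>c. scalar_mat n (g c)) (mat_alg TYPE('r) n) (map B xs)"
proof -
  let ?A = "mat_alg TYPE('r) n" and ?K = "range (\<lambda>c. scalar_mat n (g c))"
  interpret A: ring ?A by (rule ring_mat_ring)
  note K = subfield_scalars[OF n]
  have car: "set (map B xs) \<subseteq> carrier ?A" using B by (auto simp: ring_mat_simps)
  have comb: "A.combine (map (\<lambda>x. scalar_mat n (g (k x))) xs) (map B xs) =
      mat n n (\<lambda>(i, j). \<Sum>x\<in>set xs. g (k x) * B x $$ (i, j))" for k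
    using B d by (subst combine_scalar_mat) (auto simp: sum_list_distinct_conv_sum_set)
  have ex_k: "\<exists>k. Ks = map (\<lambda>x. scalar_mat n (g (k x))) xs"
    if Ks: "set Ks \<subseteq> ?K" "length Ks = length xs" for Ks
  proof -
    from Ks(1) obtain cs where cs: "Ks = map (\<lambda>c. scalar_mat n (g c)) cs"
      by (metis ex_map_conv subset_code(1) rangeE)
    define f where "f x = the (map_of (zip xs cs) x)" for x
    have cs': "cs = map f xs"
      using d Ks(2) cs by (intro nth_equalityI) (auto simp: map_of_zip_nth f_def)
    have "Ks = map (\<lambda>x. scalar_mat n (g (f x))) xs"
      unfolding cs cs' by simp
    then show ?thesis by blast
  qed
  have "A.independent ?K (map B xs)"
  proof (rule A.trivial_combine_imp_independent[OF K car])
    fix Ks assume Ks: "set Ks \<subseteq> ?K" and 0: "A.combine Ks (map B xs) = \<zero>\<^bsub>?A\<^esub>"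
    have KK: "?K \<subseteq> carrier ?A" by (auto simp: ring_mat_simps)
    \<comment> \<open>\<open>combine\<close> stops at the end of the shorter list, so the
      coefficient list is first truncated or padded with zeros to the length of
      \<open>xs\<close>.\<close>
    obtain Ks' where Ks': "set (take (length (map B xs)) Ks) \<subseteq> set Ks'"
        "set Ks' \<subseteq> set (take (length (map B xs)) Ks) \<union> {\<zero>\<^bsub>?A\<^esub>}"
        "length Ks' = length (map B xs)" "A.combine Ks' (map B xs) = \<zero>\<^bsub>?A\<^esub>"
      using A.combine_normalize[OF order.trans[OF Ks KK] car 0] by metis
    have "\<zero>\<^bsub>?A\<^esub> \<in> ?K"
      using K by (simp add: subringE(2) subfieldE(1))
    then have "set Ks' \<subseteq> ?K"
      using Ks'(2) Ks set_take_subset[of "length (map B xs)" Ks] by blast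
    then obtain k where k: "Ks' = map (\<lambda>x. scalar_mat n (g (k x))) xs"
      using ex_k[of Ks'] Ks'(3) by auto
    have "(\<Sum>x\<in>set xs. g (k x) * B x $$ (i, j)) = 0" if "i < n" "j < n" for i j
    proof -
      have "mat n n (\<lambda>(i, j). \<Sum>x\<in>set xs. g (k x) * B x $$ (i, j)) $$ (i, j) = 0\<^sub>m n n $$ (i, j)"
        using Ks'(4) unfolding k comb ring_mat_simps by simp
      then show ?thesis using that by simp
    qed
    then have "\<forall>x\<in>set xs. k x = 0" by (rule indep)
    then have "set Ks' \<subseteq> {\<zero>\<^bsub>?A\<^esub>}"
      unfolding k by (auto simp: ring_mat_simps g_zero scalar_mat_def)
    then show "set (take (length (map B xs)) Ks) \<subseteq> {\<zero>\<^bsub>?A\<^esub>}" using Ks'(1) by blast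
  qed
  moreover have "A.Span ?K (map B xs) = carrier ?A"
  proof
    show "A.Span ?K (map B xs) \<subseteq> carrier ?A"
      using A.Span_subgroup_props(1)[OF K car] .
    show "carrier ?A \<subseteq> A.Span ?K (map B xs)"
    proof
      fix M assume "M \<in> carrier ?A"
      then have M: "M \<in> carrier_mat n n" by (simp add: ring_mat_simps)
      then obtain k where "\<forall>i<n. \<forall>j<n. M $$ (i, j) = (\<Sum>x\<in>set xs. g (k x) * B x $$ (i, j))"
        using span by blast
      with M have "M = A.combine (map (\<lambda>x. scalar_mat n (g (k x))) xs) (map B xs)"
        unfolding comb by (intro eq_matI) auto
      then show "M \<in> A.Span ?K (map B xs)"
        unfolding A.Span_mem_iff_length_version[OF K car]
        by (intro exI[of _ "map (\<lambda>x. scalar_mat n (g (k x))) xs"]) auto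
    qed
  qed
  ultimately show ?thesis unfolding algebra_basis_def by blast
qed

lemma algebra_basis_dimension:
  assumes "n > 0" "algebra_basis (\<lambda>c. scalar_mat n (g c)) (mat_alg TYPE('r) n) bs"
  shows "ring.dimension (mat_alg TYPE('r) n) (length bs) (range (\<lambda>c. scalar_mat n (g c)))
    (carrier (mat_alg TYPE('r) n))"
  using assms ring.dimension_independent[OF ring_mat_ring] unfolding algebra_basis_def by metis

lemma algebra_basis_length:
  assumes "n > 0" "algebra_basis (\<lambda>c. scalar_mat n (g c)) (mat_alg TYPE('r) n) bs"
    "algebra_basis (\<lambda>c. scalar_mat n (g c)) (mat_alg TYPE('r) n) bs'"
  shows "length bs = length bs'"
  using algebra_basis_dimension[OF assms(1,2)] algebra_basis_dimension[OF assms(1,3)]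
    ring.dimension_is_inj[OF ring_mat_ring subfield_scalars[OF assms(1)]] by blast

lemma algebra_basis_dim0:
  assumes "algebra_basis (\<lambda>c. scalar_mat 0 (g c)) (mat_alg TYPE('r) 0) bs"
  shows "bs = []"
proof (cases bs)
  case (Cons u us)
  interpret A: ring "mat_alg TYPE('r) 0" by (rule ring_mat_ring)
  let ?K = "range (\<lambda>c. scalar_mat 0 (g c))"
  have span: "u \<in> A.Span ?K vs" if "u \<in> carrier_mat 0 0" "set vs \<subseteq> carrier_mat 0 0" for u vs
    using that
  proof (induction vs)
    case Nil
    then show ?case by (auto simp: ring_mat_simps)
  next
    case (Cons v vs)
    have "u = scalar_mat 0 (g 0) * v + u" using Cons.prems by (intro eq_matI) auto
    then show ?case using Cons by (auto simp: A.line_extension_mem_iff ring_mat_simps)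
  qed
  have "A.independent ?K (u # us)"
    using assms Cons by (simp add: algebra_basis_def)
  then show ?thesis
    using A.independent_backwards(1) A.independent_in_carrier[of ?K "u # us"] span[of u us]
    by (auto simp: ring_mat_simps simp del: A.Span.simps)
qed

end

section \<open>Matrix units and bases of matrix algebras\<close>

definition mat_unit :: "nat \<Rightarrow> nat \<Rightarrow> nat \<Rightarrow> 'r::zero \<Rightarrow> 'r mat" where
  "mat_unit n a b r = mat n n (\<lambda>(i, j). if i = a \<and> j = b then r else 0)"

lemma mat_unit_carrier [simp]: "mat_unit n a b r \<in> carrier_mat n n"
  by (simp add: mat_unit_def)

lemma mat_unit_index [simp]:
  "i < n \<Longrightarrow> j < n \<Longrightarrow> mat_unit n a b r $$ (i, j) = (if i = a \<and> j = b then r else 0)"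
  by (simp add: mat_unit_def)

lemma mat_unit_dim [simp]: "dim_row (mat_unit n a b r) = n" "dim_col (mat_unit n a b r) = n"
  by (simp_all add: mat_unit_def)

lemma mat_unit_mult:
  fixes r s :: "'r::ring_1"
  assumes "b < n" 
  shows "mat_unit n a b r * mat_unit n c d s = (if b = c then mat_unit n a d (r * s) else 0\<^sub>m n n)"
proof -
  have "(\<Sum>l<n. (if i = a \<and> l = b then r else 0) * (if l = c \<and> j = d then s else 0)) =
      (if b = c \<and> i = a \<and> j = d then r * s else 0)" for i j
    using assms by (subst sum.remove[of _ b]) auto
  then show ?thesis
    by (intro eq_matI) (auto simp: scalar_prod_def atLeast0LessThan)
qed

definition unit_indices :: "nat \<Rightarrow> 'j list \<Rightarrow> (nat \<times> nat \<times> 'j) list" where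
  "unit_indices n J = List.product [0..<n] (List.product [0..<n] J)"

lemma unit_indices:
  "distinct J \<Longrightarrow> distinct (unit_indices n J)" "length (unit_indices n J) = n * (n * length J)"
  "set (unit_indices n J) = {..<n} \<times> {..<n} \<times> set J"
  by (auto simp: unit_indices_def distinct_product)

lemma sum_unit_indices:
  fixes f :: "nat \<Rightarrow> nat \<Rightarrow> 'j \<Rightarrow> 'a::comm_monoid_add"
  assumes "i < n" "j < n"
  shows "(\<Sum>(a, b, t)\<in>set (unit_indices n J). if i = a \<and> j = b then f a b t else 0) = (\<Sum>t\<in>set J. f i j t)"
proof -
  have "(\<Sum>(a, b, t)\<in>set (unit_indices n J). if i = a \<and> j = b then f a b t else 0) =
      (\<Sum>a<n. \<Sum>b<n. \<Sum>t\<in>set J. if i = a \<and> j = b then f a b t else 0)"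
    by (simp add: unit_indices sum.cartesian_product)
  also have "\<dots> = (\<Sum>a<n. \<Sum>b<n. if i = a \<and> j = b then \<Sum>t\<in>set J. f a b t else 0)"
    by (intro sum.cong) auto
  also have "\<dots> = (\<Sum>a<n. if i = a then \<Sum>b<n. if j = b then \<Sum>t\<in>set J. f a b t else 0 else 0)"
    by (intro sum.cong) auto
  also have "\<dots> = (\<Sum>t\<in>set J. f i j t)"
    using assms by simp
  finally show ?thesis .
qed

text \<open>Comparing entries separates the matrix positions, so a basis \<open>h\<close> of the
  coefficient ring, placed in every position, is a basis of the matrix ring.\<close>

lemma (in central_scalars) algebra_basis_mat_units:
  assumes n: "n > 0" and J: "distinct J"
    and span: "\<And>r. \<exists>k. r = (\<Sum>t\<in>set J. g (k t) * h t)"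
    and indep: "\<And>k. (\<Sum>t\<in>set J. g (k t) * h t) = 0 \<Longrightarrow> \<forall>t\<in>set J. k t = 0"
  shows "algebra_basis (\<lambda>c. scalar_mat n (g c)) (mat_alg TYPE('r) n)
    (map (\<lambda>(a, b, t). mat_unit n a b (h t)) (unit_indices n J))"
proof -
  have entry: "(\<Sum>x\<in>set (unit_indices n J). g (k x) * (case x of (a, b, t) \<Rightarrow> mat_unit n a b (h t)) $$ (i, j)) =
      (\<Sum>t\<in>set J. g (k (i, j, t)) * h t)" if "i < n" "j < n" for k i j
    unfolding sum_unit_indices[OF that, symmetric, where f = "\<lambda>a b t. g (k (a, b, t)) * h t"]
    using that by (intro sum.cong) auto
  show ?thesis
  proof (rule algebra_basis_mat[OF n])
    fix M :: "'r mat" assume "M \<in> carrier_mat n n"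
    obtain k where k: "\<And>r. r = (\<Sum>t\<in>set J. g (k r t) * h t)" using span by metis
    show "\<exists>k. \<forall>i<n. \<forall>j<n. M $$ (i, j) =
        (\<Sum>x\<in>set (unit_indices n J). g (k x) * (case x of (a, b, t) \<Rightarrow> mat_unit n a b (h t)) $$ (i, j))"
      by (intro exI[of _ "\<lambda>(a, b, t). k (M $$ (a, b)) t"]) (simp add: entry flip: k)
  next
    fix k
    assume *: "\<And>i j. i < n \<Longrightarrow> j < n \<Longrightarrow>
      (\<Sum>x\<in>set (unit_indices n J). g (k x) * (case x of (a, b, t) \<Rightarrow> mat_unit n a b (h t)) $$ (i, j)) = 0"
    have "\<forall>t\<in>set J. k (i, j, t) = 0" if "i < n" "j < n" for i j
      using *[OF that] unfolding entry[OF that] by (rule indep)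
    then show "\<forall>x\<in>set (unit_indices n J). k x = 0" by (auto simp: unit_indices)
  qed (use J in \<open>auto simp: unit_indices\<close>)
qed

interpretation self_scalars: central_scalars "\<lambda>c :: 'l::field. c"
  by unfold_locales auto

interpretation quat_scalars: central_scalars "quat_of :: 'l::field \<Rightarrow> 'l quat"
  by unfold_locales (auto simp: quat_of_def quat_defs)

lemma self_mat_basis:
  assumes "n > 0"
  shows "\<exists>bs. algebra_basis (scalar_mat n) (mat_alg TYPE('l::field) n) bs \<and> length bs = n\<^sup>2"
proof -
  \<comment> \<open>A field has the basis 1 over itself, hence the one-element index list
    \<open>[()]\<close>.\<close>
  have "algebra_basis (scalar_mat n) (mat_alg TYPE('l::field) n)
      (map (\<lambda>(a, b, t). mat_unit n a b 1) (unit_indices n [()]))"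
    by (rule self_scalars.algebra_basis_mat_units[OF assms]) (auto intro: exI[of _ "\<lambda>_. _"])
  then show ?thesis by (fastforce simp: unit_indices power2_eq_square)
qed

definition quat_unit :: "nat \<Rightarrow> 'a::comm_ring_1 quat" where
  "quat_unit t = [1, quat_I, quat_J, quat_K] ! t"

definition quat_mat_basis :: "nat \<Rightarrow> 'a::comm_ring_1 quat mat list" where
  "quat_mat_basis n = map (\<lambda>(a, b, t). mat_unit n a b (quat_unit t)) (unit_indices n [0..<4])"

lemma quat_combination:
  "(\<Sum>t\<in>{0..<4}. quat_of (k t) * quat_unit t) = Quat (k 0) (k 1) (k 2) (k (3::nat))"
  by (simp add: quat_unit_def numeral_eq_Suc quat_of_def quat_defs quat_I_def quat_J_def quat_K_def)

lemma quat_mat_basis: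
  assumes "n > 0"
  shows "algebra_basis (quat_scalar n) (mat_alg TYPE('l::field quat) n) (quat_mat_basis n)"
    and "length (quat_mat_basis n :: 'l quat mat list) = 4 * n\<^sup>2"
proof -
  have "quat_scalar n = (\<lambda>c :: 'l. scalar_mat n (quat_of c))" by (simp add: fun_eq_iff quat_scalar_def)
  moreover have "algebra_basis (\<lambda>c :: 'l. scalar_mat n (quat_of c)) (mat_alg TYPE('l quat) n) (quat_mat_basis n)"
    unfolding quat_mat_basis_def
  proof (rule quat_scalars.algebra_basis_mat_units[OF assms])
    fix r :: "'l quat"
    show "\<exists>k. r = (\<Sum>t\<in>set [0..<4]. quat_of (k t) * quat_unit t)"
      unfolding set_upt quat_combination
      by (intro exI[of _ "\<lambda>t. [q1 r, qi r, qj r, qk r] ! t"]) (simp add: numeral_eq_Suc)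
  next
    fix k :: "nat \<Rightarrow> 'l"
    assume "(\<Sum>t\<in>set [0..<4]. quat_of (k t) * quat_unit t) = 0"
    then show "\<forall>t\<in>set [0..<4]. k t = 0"
      unfolding set_upt quat_combination
      by (auto simp: zero_quat_def numeral_eq_Suc less_Suc_eq)
  qed simp
  ultimately show "algebra_basis (quat_scalar n) (mat_alg TYPE('l::field quat) n) (quat_mat_basis n)" by simp
qed (simp add: quat_mat_basis_def unit_indices power2_eq_square)

section \<open>The reduced trace\<close>

lemma trace_mult_comm:
  fixes M N :: "'l::comm_ring_1 mat"
  assumes "M \<in> carrier_mat n n" "N \<in> carrier_mat n n"
  shows "(\<Sum>i<n. (M * N) $$ (i, i)) = (\<Sum>i<n. (N * M) $$ (i, i))"
proof -
  have "(\<Sum>i<n. (M * N) $$ (i, i)) = (\<Sum>i<n. \<Sum>j<n. M $$ (i, j) * N $$ (j, i))"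
    using assms by (intro sum.cong) (auto simp: scalar_prod_def atLeast0LessThan)
  also have "\<dots> = (\<Sum>j<n. \<Sum>i<n. N $$ (j, i) * M $$ (i, j))"
    by (subst sum.swap) (simp add: mult.commute)
  also have "\<dots> = (\<Sum>i<n. (N * M) $$ (i, i))"
    using assms by (intro sum.cong) (auto simp: scalar_prod_def atLeast0LessThan)
  finally show ?thesis .
qed

text \<open>Modulo commutators, every element of \<open>M\<^sub>3(H)\<close> is a scalar; so the trace of any splitting
  representation is determined by its value at \<open>1\<close>, which the dimension forces to be \<open>6\<close>.\<close>

lemma splitting_trace:
  fixes \<phi> :: "'f::field quat mat \<Rightarrow> 'f alg_closure mat"
  assumes spl: "splitting to_ac (quat_scalar 3) (mat_alg TYPE('f quat) 3) n \<phi>"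
    and two: "(2 :: 'f) \<noteq> 0" and three: "(3 :: 'f) \<noteq> 0" and M: "M \<in> carrier_mat 3 3"
  shows "(\<Sum>i<n. \<phi> M $$ (i, i)) = to_ac (2 * (\<Sum>a<3. q1 (M $$ (a, a))))"
proof -
  let ?A = "mat_alg TYPE('f quat) 3" and ?B = "mat_alg TYPE('f alg_closure) n"
  from spl obtain bs where hom: "\<phi> \<in> Ring.ring_hom ?A ?B"
    and sc: "\<And>c. \<phi> (quat_scalar 3 c) = scalar_mat n (to_ac c)"
    and bs: "algebra_basis (quat_scalar 3) ?A bs" "algebra_basis (scalar_mat n) ?B (map \<phi> bs)"
    unfolding splitting_def scalar_extension_def by blast
  have qs: "quat_scalar 3 = (\<lambda>c :: 'f. scalar_mat 3 (quat_of c))" by (simp add: fun_eq_iff quat_scalar_def)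
  \<comment> \<open>\<open>36 = 4 * 9\<close> is the dimension of \<open>M_3(H)\<close>. The image
    of the basis has the same length and is a basis of the \<open>n\<close> by \<open>n\<close>
    matrices, so \<open>n = 6\<close>.\<close>
  have len: "length bs = 36"
    using quat_scalars.algebra_basis_length[of 3 bs "quat_mat_basis 3"] bs(1) quat_mat_basis[where 'l = 'f, of 3]
    by (simp add: qs)
  have car: "\<phi> x \<in> carrier_mat n n" if "x \<in> carrier_mat 3 3" for x
    using ring_hom_memE(1)[OF hom, of x] that by (simp add: ring_mat_simps)
  have mult: "\<phi> (x * y) = \<phi> x * \<phi> y" and add: "\<phi> (x + y) = \<phi> x + \<phi> y"
    if "x \<in> carrier_mat 3 3" "y \<in> carrier_mat 3 3" for x y
    using ring_hom_memE(2,3)[OF hom, of x y] that by (simp_all add: ring_mat_simps)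
  have one: "\<phi> (1\<^sub>m 3) = 1\<^sub>m n"
    using ring_hom_memE(4)[OF hom] by (simp add: ring_mat_simps)
  have "n \<noteq> 0"
    using self_scalars.algebra_basis_dim0[of "map \<phi> bs"] bs(2) len by (metis list.size(3) map_is_Nil_conv numeral_eq_iff zero_neq_numeral)
  then have n: "n > 0" by simp
  obtain bs' where "algebra_basis (scalar_mat n) ?B bs'" "length bs' = n\<^sup>2"
    using self_mat_basis[OF n, where 'l = "'f alg_closure"] by blast
  then have "n\<^sup>2 = 36"
    using self_scalars.algebra_basis_length[OF n, of bs' "map \<phi> bs"] bs(2) len by simp
  then have n6: "n = 6"
    using power2_eq_iff_nonneg[of n 6] by simp
  define T where "T x = (\<Sum>i<n. \<phi> x $$ (i, i))" for x
  let ?E = "\<lambda>a b h. mat_unit 3 a b h :: 'f quat mat"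
  have T_comm: "T (x * y) = T (y * x)" if "x \<in> carrier_mat 3 3" "y \<in> carrier_mat 3 3" for x y
    unfolding T_def mult[OF that] mult[OF that(2,1)] by (rule trace_mult_comm) (use that car in auto)
  have T_add: "T (x + y) = T x + T y" if "x \<in> carrier_mat 3 3" "y \<in> carrier_mat 3 3" for x y
    unfolding T_def add[OF that] using car[OF that(1)] car[OF that(2)] by (simp add: sum.distrib)
  have T_smult: "T (quat_of c \<cdot>\<^sub>m x) = to_ac c * T x" if "x \<in> carrier_mat 3 3" for c x
  proof -
    have "quat_of c \<cdot>\<^sub>m x = quat_scalar 3 c * x"
      using that by (simp add: quat_scalar_def scalar_mat_mult)
    moreover have "\<phi> (quat_scalar 3 c * x) = to_ac c \<cdot>\<^sub>m \<phi> x"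
      using mult[of "quat_scalar 3 c" x] that sc car[OF that] by (simp add: quat_scalar_def scalar_mat_mult)
    ultimately show ?thesis
      using car[OF that] by (simp add: T_def sum_distrib_left)
  qed
  have T_0: "T (0\<^sub>m 3 3) = 0"
    using T_add[of "0\<^sub>m 3 3" "0\<^sub>m 3 3"]
    by (metis add_cancel_right_right left_add_zero_mat zero_carrier_mat)
  have T_one: "T (1\<^sub>m 3) = 6"
    by (simp add: T_def one n6)
  \<comment> \<open>Multiplying by the idempotent at \<open>(a, a)\<close> from the left keeps the
    matrix unit at \<open>(a, b)\<close>; multiplying from the right kills it.\<close>
  have off: "T (?E a b h) = 0" if "a < 3" "b < 3" "a \<noteq> b" for a b h
    using T_comm[of "?E a a 1" "?E a b h"] that by (simp add: mat_unit_mult T_0)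
  have diag: "T (?E a a h) = T (?E b b h)" if "a < 3" "b < 3" for a b h
    using T_comm[of "?E a b h" "?E b a 1"] that by (simp add: mat_unit_mult)
  have E_add: "?E a b (h + h') = ?E a b h + ?E a b h'" for a b h h'
    by (intro eq_matI) auto
  have E_0: "?E a b 0 = 0\<^sub>m 3 3" for a b
    by (intro eq_matI) auto
  have E_smult: "?E a b (quat_of c * h) = quat_of c \<cdot>\<^sub>m ?E a b h" for a b c h
    by (intro eq_matI) auto
  have two': "(2 :: 'f alg_closure) \<noteq> 0" "(3 :: 'f alg_closure) \<noteq> 0"
    using two three to_ac_numeral[where 'a = 'f] to_ac_eq_0_iff by metis+
  \<comment> \<open>The products \<open>x * y\<close> and \<open>y * x\<close> have the same trace,
    but also opposite ones, so twice the trace vanishes. This removes the pure quaternions, by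
    \<open>I = J * K\<close>, \<open>J = K * I\<close> and \<open>K = I * J\<close>.\<close>
  have anti: "T (?E a a (x * y)) = 0" if "a < 3" "y * x = - (x * y)" for a x y
  proof -
    have "T (?E a a (x * y)) = T (?E a a (y * x))"
      using T_comm[of "?E a a x" "?E a a y"] that by (simp add: mat_unit_mult)
    moreover have "T (?E a a (x * y)) + T (?E a a (- (x * y))) = 0"
      using T_add[of "?E a a (x * y)" "?E a a (- (x * y))"] E_add[of a a "x * y" "- (x * y)"] T_0 E_0[of a a]
      by simp
    ultimately have "2 * T (?E a a (x * y)) = 0"
      using that by simp
    then show ?thesis using two' by simp
  qed
  have pure: "T (?E a a quat_I) = 0" "T (?E a a quat_J) = 0" "T (?E a a quat_K) = 0" if "a < 3" for a
    using anti[OF that, where x = quat_J and y = quat_K] anti[OF that, where x = quat_K and y = quat_I] anti[OF that, where x = quat_I and y = quat_J]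
    by (simp_all add: quat_I_def quat_J_def quat_K_def quat_defs)
  have T_diag: "T (?E a a h) = to_ac (q1 h) * T (?E a a 1)" if a: "a < 3" for a h
  proof -
    have "T (?E a a h) = T (?E a a (quat_of (q1 h) * 1 + quat_of (qi h) * quat_I +
        quat_of (qj h) * quat_J + quat_of (qk h) * quat_K))"
      by (simp only: mult_1_right flip: quat_decomp)
    also have "\<dots> = to_ac (q1 h) * T (?E a a 1)"
      by (simp only: E_add E_smult T_add T_smult add_carrier_mat smult_carrier_mat mat_unit_carrier pure[OF a]) simp
    finally show ?thesis .
  qed
  have dec: "M = ?E 0 0 (M $$ (0,0)) + ?E 0 1 (M $$ (0,1)) + ?E 0 2 (M $$ (0,2)) +
      ?E 1 0 (M $$ (1,0)) + ?E 1 1 (M $$ (1,1)) + ?E 1 2 (M $$ (1,2)) +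
      ?E 2 0 (M $$ (2,0)) + ?E 2 1 (M $$ (2,1)) + ?E 2 2 (M $$ (2,2))" if "M \<in> carrier_mat 3 3" for M
    using that by (intro eq_matI) (auto simp: numeral_eq_Suc less_Suc_eq)
  have T_dec: "T M = to_ac (\<Sum>a<3. q1 (M $$ (a, a))) * T (?E 0 0 1)" if "M \<in> carrier_mat 3 3" for M
  proof -
    have "T M = T (?E 0 0 (M $$ (0,0))) + T (?E 1 1 (M $$ (1,1))) + T (?E 2 2 (M $$ (2,2)))"
      by (subst dec[OF that]) (simp only: T_add add_carrier_mat mat_unit_carrier off, simp add: off)
    also have "\<dots> = to_ac (\<Sum>a<3. q1 (M $$ (a, a))) * T (?E 0 0 1)"
      using T_diag[of 0 "M $$ (0,0)"] T_diag[of 1 "M $$ (1,1)"] T_diag[of 2 "M $$ (2,2)"] diag[of 1 0 1] diag[of 2 0 1]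
      by (simp add: numeral_eq_Suc algebra_simps)
    finally show ?thesis .
  qed
  \<comment> \<open>The identity has trace 6 and consists of three diagonal units of equal trace;
    each therefore has trace 2 once 3 is invertible.\<close>
  have "3 * (T (?E 0 0 1) - 2) = 0"
    using T_dec[of "1\<^sub>m 3"] T_one by (simp add: numeral_eq_Suc one_quat_def)
  then have "T (?E 0 0 1) - 2 = 0" using two'(2) by (metis mult_eq_0_iff)
  then have "T (?E 0 0 1) = 2" by simp
  then show ?thesis using T_dec[OF M] by (simp add: T_def mult.commute)
qed

text \<open>The given splitting yields existence in the definite description. Uniqueness holds
  because \<open>splitting_trace\<close> gives the same value in every splitting and
  \<open>to_ac\<close> is injective.\<close>

lemma Trd_quat_mat:
  fixes \<phi> :: "'f::field quat mat \<Rightarrow> 'f alg_closure mat"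
  assumes spl: "splitting to_ac (quat_scalar 3) (mat_alg TYPE('f quat) 3) n \<phi>"
    and two: "(2 :: 'f) \<noteq> 0" and three: "(3 :: 'f) \<noteq> 0" and M: "M \<in> carrier_mat 3 3"
  shows "Trd (quat_scalar 3) (mat_alg TYPE('f quat) 3) M = 2 * (\<Sum>a<3. q1 (M $$ (a, a)))"
  unfolding Trd_def
proof (rule the_equality)
  show "\<exists>n \<phi>. splitting to_ac (quat_scalar 3) (mat_alg TYPE('f quat) 3) n \<phi> \<and>
      to_ac (2 * (\<Sum>a<3. q1 (M $$ (a, a)))) = (\<Sum>i<n. \<phi> M $$ (i, i))"
    by (intro exI conjI, rule spl, rule splitting_trace[OF spl two three M, symmetric])
next
  fix c
  assume "\<exists>n \<phi>. splitting to_ac (quat_scalar 3) (mat_alg TYPE('f quat) 3) n \<phi> \<and>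
      to_ac c = (\<Sum>i<n. \<phi> M $$ (i, i))"
  then obtain m \<psi> where "splitting to_ac (quat_scalar 3) (mat_alg TYPE('f quat) 3) m \<psi>"
    and c: "to_ac c = (\<Sum>i<m. \<psi> M $$ (i, i))" by blast
  from splitting_trace[OF this(1) two three M] show "c = 2 * (\<Sum>a<3. q1 (M $$ (a, a)))"
    unfolding c [symmetric] by (simp only: to_ac_eq_iff)
qed

section \<open>Splitting $M_n(H)$\<close>

text \<open>With \<open>\<iota>\<^sup>2 = -1\<close>, the quaternion \<open>a + b i + c j + d k\<close> acts as the matrix with rows
  \<open>(a + b \<iota>, c + d \<iota>)\<close> and \<open>(- c + d \<iota>, a - b \<iota>)\<close>.\<close>

definition quat_rep :: "('f::field \<Rightarrow> 'l::field) \<Rightarrow> 'l \<Rightarrow> 'f quat \<Rightarrow> nat \<Rightarrow> nat \<Rightarrow> 'l" where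
  "quat_rep h \<iota> x u v =
    (if u = 0 then if v = 0 then h (q1 x) + \<iota> * h (qi x) else h (qj x) + \<iota> * h (qk x)
     else if v = 0 then - h (qj x) + \<iota> * h (qk x) else h (q1 x) - \<iota> * h (qi x))"

definition mat_rep :: "('f::field \<Rightarrow> 'l::field) \<Rightarrow> 'l \<Rightarrow> nat \<Rightarrow> 'f quat mat \<Rightarrow> 'l mat" where
  "mat_rep h \<iota> n M = mat (2 * n) (2 * n) (\<lambda>(i, j). quat_rep h \<iota> (M $$ (i div 2, j div 2)) (i mod 2) (j mod 2))"

lemma sum_double:
  fixes f :: "nat \<Rightarrow> 'a::comm_monoid_add"
  shows "(\<Sum>i<2 * n. f i) = (\<Sum>a<n. f (2 * a) + f (2 * a + 1))"
  by (induction n) (simp_all add: add.assoc)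

text \<open>A square root of \<open>-1\<close> in \<open>L\<close> suffices to represent
  \<open>H\<close> by 2 by 2 matrices. That 2 is nonzero makes the images of \<open>1\<close>,
  \<open>i\<close>, \<open>j\<close>, \<open>k\<close> independent over \<open>L\<close>.\<close>

locale quat_splitting =
  fixes h :: "'f::field \<Rightarrow> 'l::field" and \<iota> :: 'l
  assumes h_add: "h (x + y) = h x + h y"
    and h_mult: "h (x * y) = h x * h y"
    and h_one: "h 1 = 1"
    and \<iota>: "\<iota> * \<iota> = - 1"
    and two: "(2 :: 'l) \<noteq> 0"
begin

lemma h_zero: "h 0 = 0"
  using h_add[of 0 0] by (metis add.right_neutral add_cancel_right_right)

lemma h_minus: "h (- x) = - h x"
  using h_add[of x "- x"] by (simp add: h_zero eq_neg_iff_add_eq_0 add.commute)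

lemma h_diff: "h (x - y) = h x - h y"
  using h_add[of x "- y"] by (simp add: h_minus)

abbreviation "\<rho> \<equiv> quat_rep h \<iota>"
abbreviation "\<phi> \<equiv> mat_rep h \<iota>"

lemma rep_add: "\<rho> (x + y) u v = \<rho> x u v + \<rho> y u v"
  by (simp add: quat_rep_def quat_defs h_add algebra_simps)

lemma rep_mult: "\<rho> (x * y) u v = \<rho> x u 0 * \<rho> y 0 v + \<rho> x u 1 * \<rho> y 1 v"
proof -
  have \<iota>\<iota>: "\<iota> * (\<iota> * z) = - z" for z using \<iota> by (metis mult.assoc mult_minus1)
  show ?thesis
    by (simp add: quat_rep_def quat_defs h_add h_mult h_diff algebra_simps \<iota>\<iota>)
qed

lemma rep_zero: "\<rho> 0 u v = 0"
  by (simp add: quat_rep_def quat_defs h_zero)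

lemma rep_sum: "\<rho> (\<Sum>i\<in>I. f i) u v = (\<Sum>i\<in>I. \<rho> (f i) u v)"
  by (induction I rule: infinite_finite_induct) (simp_all add: rep_zero rep_add)

lemma mat_rep_carrier [simp]: "\<phi> n M \<in> carrier_mat (2 * n) (2 * n)"
  by (simp add: mat_rep_def)

lemma mat_rep_dim [simp]: "dim_row (\<phi> n M) = 2 * n" "dim_col (\<phi> n M) = 2 * n"
  by (simp_all add: mat_rep_def)

lemma mat_rep_index:
  "i < 2 * n \<Longrightarrow> j < 2 * n \<Longrightarrow> \<phi> n M $$ (i, j) = \<rho> (M $$ (i div 2, j div 2)) (i mod 2) (j mod 2)"
  by (simp add: mat_rep_def)

lemma div_less: "i < 2 * n \<Longrightarrow> i div 2 < (n :: nat)"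
  by (simp add: less_mult_imp_div_less mult.commute)

lemma mat_rep_add:
  assumes "M \<in> carrier_mat n n" "N \<in> carrier_mat n n"
  shows "\<phi> n (M + N) = \<phi> n M + \<phi> n N"
  using assms by (intro eq_matI) (auto simp: mat_rep_index div_less rep_add)

lemma mat_rep_mult:
  assumes M: "M \<in> carrier_mat n n" and N: "N \<in> carrier_mat n n"
  shows "\<phi> n (M * N) = \<phi> n M * \<phi> n N"
proof (rule eq_matI)
  fix i j assume ij: "i < dim_row (\<phi> n M * \<phi> n N)" "j < dim_col (\<phi> n M * \<phi> n N)"
  then have ij: "i < 2 * n" "j < 2 * n" by simp_all
  have "(\<phi> n M * \<phi> n N) $$ (i, j) = (\<Sum>t<2 * n. \<phi> n M $$ (i, t) * \<phi> n N $$ (t, j))"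
    using ij by (simp add: scalar_prod_def atLeast0LessThan)
  also have "\<dots> = (\<Sum>a<n. \<rho> (M $$ (i div 2, a)) (i mod 2) 0 * \<rho> (N $$ (a, j div 2)) 0 (j mod 2) +
      \<rho> (M $$ (i div 2, a)) (i mod 2) 1 * \<rho> (N $$ (a, j div 2)) 1 (j mod 2))"
    unfolding sum_double using ij by (intro sum.cong) (auto simp: mat_rep_index)
  also have "\<dots> = (\<Sum>a<n. \<rho> (M $$ (i div 2, a) * N $$ (a, j div 2)) (i mod 2) (j mod 2))"
    by (simp only: rep_mult)
  also have "\<dots> = \<rho> ((M * N) $$ (i div 2, j div 2)) (i mod 2) (j mod 2)"
    using M N div_less[OF ij(1)] div_less[OF ij(2)] by (simp add: scalar_prod_def atLeast0LessThan rep_sum)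
  finally show "\<phi> n (M * N) $$ (i, j) = (\<phi> n M * \<phi> n N) $$ (i, j)"
    using ij by (simp add: mat_rep_index)
qed simp_all

lemma mat_rep_scalar: "\<phi> n (quat_scalar n c) = scalar_mat (2 * n) (h c)"
proof (rule eq_matI)
  fix i j assume "i < dim_row (scalar_mat (2 * n) (h c))" "j < dim_col (scalar_mat (2 * n) (h c))"
  then have ij: "i < 2 * n" "j < 2 * n" by (simp_all add: scalar_mat_def)
  have "i = j \<longleftrightarrow> i div 2 = j div 2 \<and> i mod 2 = j mod 2"
    by (metis div_mult_mod_eq)
  then show "\<phi> n (quat_scalar n c) $$ (i, j) = scalar_mat (2 * n) (h c) $$ (i, j)"
    using ij div_less[OF ij(1)] div_less[OF ij(2)]
    by (auto simp: mat_rep_index quat_scalar_def scalar_mat_def quat_rep_def quat_of_def h_zero quat_defs)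
qed (simp_all add: scalar_mat_def)

lemma mat_rep_one: "\<phi> n (1\<^sub>m n) = 1\<^sub>m (2 * n)"
  using mat_rep_scalar[of n 1] by (simp add: quat_scalar_def h_one quat_of_1 scalar_mat_one)

lemma mat_rep_hom: "\<phi> n \<in> Ring.ring_hom (mat_alg TYPE('f quat) n) (mat_alg TYPE('l) (2 * n))"
  by (rule ring_hom_memI) (auto simp: ring_mat_simps mat_rep_mult mat_rep_add mat_rep_one)

lemma rep_units:
  "\<rho> (quat_unit 0) u v = (if (u = 0) = (v = 0) then 1 else 0)"
  "\<rho> (quat_unit 1) u v = (if (u = 0) = (v = 0) then if u = 0 then \<iota> else - \<iota> else 0)"
  "\<rho> (quat_unit 2) u v = (if (u = 0) = (v = 0) then 0 else if u = 0 then 1 else - 1)"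
  "\<rho> (quat_unit 3) u v = (if (u = 0) = (v = 0) then 0 else \<iota>)"
  by (simp_all add: quat_rep_def quat_unit_def quat_defs quat_I_def quat_J_def quat_K_def h_zero h_one)

lemma mat_rep_basis:
  assumes "n > 0"
  shows "algebra_basis (scalar_mat (2 * n)) (mat_alg TYPE('l) (2 * n)) (map (\<phi> n) (quat_mat_basis n))"
proof -
  define B where "B = (\<lambda>(a, b, t). \<phi> n (mat_unit n a b (quat_unit t)))"
  have entry: "(\<Sum>x\<in>set (unit_indices n [0..<4]). k x * B x $$ (i, j)) =
      (\<Sum>t\<in>{0..<4}. k (i div 2, j div 2, t) * \<rho> (quat_unit t) (i mod 2) (j mod 2))"
    if ij: "i < 2 * n" "j < 2 * n" for k i j
  proof -
    have "(\<Sum>x\<in>set (unit_indices n [0..<4]). k x * B x $$ (i, j)) =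
      (\<Sum>(a, b, t)\<in>set (unit_indices n [0..<4]).
        if i div 2 = a \<and> j div 2 = b then k (a, b, t) * \<rho> (quat_unit t) (i mod 2) (j mod 2) else 0)"
      using ij div_less[OF ij(1)] div_less[OF ij(2)]
      by (intro sum.cong) (auto simp: B_def mat_rep_index rep_zero)
    then show ?thesis
      unfolding sum_unit_indices[OF div_less[OF ij(1)] div_less[OF ij(2)]] by simp
  qed
  have sum4: "(\<Sum>t\<in>{0..<4}. f t) = f 0 + f 1 + f 2 + f 3" for f :: "nat \<Rightarrow> 'l"
    by (simp add: numeral_eq_Suc)
  have \<iota>0: "\<iota> \<noteq> 0" using \<iota> by auto
  have "algebra_basis (\<lambda>c. scalar_mat (2 * n) c) (mat_alg TYPE('l) (2 * n)) (map B (unit_indices n [0..<4]))"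
  proof (rule self_scalars.algebra_basis_mat)
    fix M :: "'l mat"
    \<comment> \<open>Solves the block with rows \<open>(p + q \<iota>, r + s \<iota>)\<close> and
      \<open>(- r + s \<iota>, p - q \<iota>)\<close> for \<open>p\<close>, \<open>q\<close>,
      \<open>r\<close>, \<open>s\<close>; hence the denominators \<open>2\<close> and
      \<open>2 * \<iota>\<close>.\<close>
    define k where "k = (\<lambda>(a, b, t). let m = \<lambda>u v. M $$ (2 * a + u, 2 * b + v) in
      [(m 0 0 + m 1 1) / 2, (m 0 0 - m 1 1) / (2 * \<iota>), (m 0 1 - m 1 0) / 2, (m 0 1 + m 1 0) / (2 * \<iota>)] ! t)"
    have four: "(4 :: 'l) \<noteq> 0" using two mult_eq_0_iff[of 2 "2 :: 'l"] by simp
    have "M $$ (i, j) = (\<Sum>x\<in>set (unit_indices n [0..<4]). k x * B x $$ (i, j))"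
      if ij: "i < 2 * n" "j < 2 * n" for i j
    proof -
      define a b u v where "a = i div 2" and "b = j div 2" and "u = i mod 2" and "v = j mod 2"
      have "i = 2 * a + u" "j = 2 * b + v" by (simp_all add: a_def b_def u_def v_def)
      then have "M $$ (i, j) = M $$ (2 * a + u, 2 * b + v)" by simp
      also have "\<dots> = k (a, b, 0) * \<rho> (quat_unit 0) u v + k (a, b, 1) * \<rho> (quat_unit 1) u v +
          k (a, b, 2) * \<rho> (quat_unit 2) u v + k (a, b, 3) * \<rho> (quat_unit 3) u v"
      proof -
        have "u = 0 \<or> u = 1" "v = 0 \<or> v = 1" by (auto simp: u_def v_def)
        then show ?thesis
          by (elim disjE) (simp_all add: k_def rep_units rep_units(2)[unfolded One_nat_def] \<iota>0 two four field_simps)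
      qed
      finally show ?thesis
        unfolding entry[OF ij] sum4 by (simp add: a_def b_def u_def v_def)
    qed
    then show "\<exists>k. \<forall>i<2 * n. \<forall>j<2 * n. M $$ (i, j) = (\<Sum>x\<in>set (unit_indices n [0..<4]). k x * B x $$ (i, j))"
      by blast
  next
    fix k
    assume *: "\<And>i j. i < 2 * n \<Longrightarrow> j < 2 * n \<Longrightarrow> (\<Sum>x\<in>set (unit_indices n [0..<4]). k x * B x $$ (i, j)) = 0"
    have "k (a, b, t) = 0" if ab: "a < n" "b < n" "t < 4" for a b t
    proof -
      have e: "k (a, b, 0) * \<rho> (quat_unit 0) u v + k (a, b, 1) * \<rho> (quat_unit 1) u v +
          k (a, b, 2) * \<rho> (quat_unit 2) u v + k (a, b, 3) * \<rho> (quat_unit 3) u v = 0" if "u < 2" "v < 2" for u v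
        using *[of "2 * a + u" "2 * b + v"] entry[of "2 * a + u" "2 * b + v" k] ab that
        by (simp add: sum4)
      \<comment> \<open>The diagonal entries of a block give such a pair of equations with
        \<open>c = \<iota>\<close>, and so do the off-diagonal ones up to a sign.\<close>
      have z: "x = 0 \<and> y = 0" if "x + y * c = 0" "x - y * c = 0" "c \<noteq> 0" for x y c :: 'l
      proof -
        have "2 * x = (x + y * c) + (x - y * c)" by simp
        then have "2 * x = 0" by (simp only: that add_0)
        then show ?thesis using that two by simp
      qed
      have "k (a, b, 0) = 0 \<and> k (a, b, 1) = 0"
        using e[of 0 0] e[of 1 1] \<iota>0 by (intro z[of _ _ \<iota>]) (simp_all add: rep_units rep_units(2)[unfolded One_nat_def])
      moreover have "k (a, b, 2) = 0 \<and> k (a, b, 3) = 0"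
        using e[of 0 1] e[of 1 0] \<iota>0 by (intro z[of _ _ \<iota>]) (simp_all add: rep_units rep_units(2)[unfolded One_nat_def] algebra_simps)
      ultimately show ?thesis using ab(3) by (auto simp: numeral_eq_Suc less_Suc_eq)
    qed
    then show "\<forall>x\<in>set (unit_indices n [0..<4]). k x = 0" by (auto simp: unit_indices)
  qed (use assms in \<open>auto simp: unit_indices B_def\<close>)
  moreover have "map B (unit_indices n [0..<4]) = map (\<phi> n) (quat_mat_basis n)"
    by (simp add: quat_mat_basis_def B_def split_def comp_def)
  ultimately show ?thesis by simp
qed

lemma scalar_extension_mat_rep:
  assumes "n > 0"
  shows "scalar_extension h (quat_scalar n) (mat_alg TYPE('f quat) n)
    (scalar_mat (2 * n)) (mat_alg TYPE('l) (2 * n)) (\<phi> n)"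
  unfolding scalar_extension_def
  using mat_rep_hom mat_rep_scalar mat_rep_basis[OF assms] quat_mat_basis(1)[OF assms] by blast

end

lemma alg_closed_sqrt_minus_one: "\<exists>\<iota> :: 'l::alg_closed_field. \<iota> * \<iota> = - 1"
proof -
  obtain x :: 'l where "poly [:1, 0, 1:] x = 0"
    using alg_closed_imp_poly_has_root[of "[:1, 0, 1 :: 'l:]"] by auto
  then have "x * x = - 1" by (simp add: eq_neg_iff_add_eq_0 add.commute)
  then show ?thesis ..
qed

lemma to_ac_quat_splitting:
  assumes "(2 :: 'f::field) \<noteq> 0"
  shows "\<exists>\<iota>. quat_splitting (to_ac :: 'f \<Rightarrow> 'f alg_closure) \<iota>"
proof -
  have "(2 :: 'f alg_closure) \<noteq> 0"
    using assms to_ac_numeral[where 'a = 'f] to_ac_eq_0_iff by metis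
  then show ?thesis
    using alg_closed_sqrt_minus_one[where 'l = "'f alg_closure"] by (auto simp: quat_splitting_def)
qed

section \<open>Involutions adjoint to diagonal forms\<close>

lemma quat_conj_add: "quat_conj (x + y) = quat_conj x + quat_conj y"
  by (simp add: quat_conj_def quat_defs)

lemma quat_conj_mult: "quat_conj (x * y) = quat_conj y * quat_conj x"
  by (simp add: quat_conj_def quat_defs algebra_simps)

lemma quat_conj_conj: "quat_conj (quat_conj x) = x"
  by (simp add: quat_conj_def)

lemma quat_conj_zero: "quat_conj 0 = 0"
  by (simp add: quat_conj_def quat_defs)

lemma quat_conj_of: "quat_conj (quat_of c) = quat_of c"
  by (simp add: quat_conj_def quat_of_def)

lemma quat_conj_sum: "quat_conj (\<Sum>i\<in>I. f i) = (\<Sum>i\<in>I. quat_conj (f i))"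
  by (induction I rule: infinite_finite_induct) (simp_all add: quat_conj_zero quat_conj_add)

locale diagonal_form =
  fixes n :: nat and g :: "nat \<Rightarrow> 'f::field"
  assumes n: "n > 0" and g: "\<And>i. i < n \<Longrightarrow> g i \<noteq> 0"
begin

abbreviation "\<sigma> \<equiv> tens_map (ad_involution (mat_diag n g)) quat_conj"

text \<open>The elimination behind \<open>mat_inverse\<close> is not unfolded: it succeeds because
  the matrix is a unit, and inverses are unique.\<close>

lemma inverse_diag: "the (mat_inverse (mat_diag n g)) = mat_diag n (\<lambda>i. inverse (g i))"
proof -
  let ?G = "mat_diag n g" and ?H = "mat_diag n (\<lambda>i. inverse (g i))"
  have GH: "?G * ?H = 1\<^sub>m n" "?H * ?G = 1\<^sub>m n"
    unfolding mat_diag_diag using g by (auto intro!: eq_matI simp: mat_diag_def)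
  then have "?G \<in> Units (ring_mat TYPE('f) n ())"
    by (auto simp: Units_def ring_mat_simps intro!: bexI[of _ ?H])
  then obtain B where B: "mat_inverse ?G = Some B"
    using mat_inverse(1)[OF mat_diag_dim, of n g "()"] by (cases "mat_inverse ?G") auto
  then have inv: "?G * B = 1\<^sub>m n" "B \<in> carrier_mat n n"
    using mat_inverse(2)[OF mat_diag_dim] by auto
  have "B = (?H * ?G) * B" using inv GH by simp
  also have "\<dots> = ?H * (?G * B)" using inv by (intro assoc_mult_mat[of _ n n _ n _ n]) auto
  also have "\<dots> = ?H" using inv(1) right_mult_one_mat[OF mat_diag_dim] by simp
  finally show ?thesis using B by simp
qed

lemma ad_involution_diag:
  assumes "Z \<in> carrier_mat n n"
  shows "ad_involution (mat_diag n g) Z = mat n n (\<lambda>(i, j). g i * Z $$ (j, i) / g j)"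
proof -
  have Zt: "transpose_mat Z \<in> carrier_mat n n" using assms by simp
  have car: "mat n n (\<lambda>(i, j). g i * transpose_mat Z $$ (i, j)) \<in> carrier_mat n n" by simp
  show ?thesis
    unfolding ad_involution_def inverse_diag mat_diag_mult_left[OF Zt] mat_diag_mult_right[OF car]
    using assms by (intro eq_matI) (auto simp: divide_inverse)
qed

lemma sigma_carrier [simp]: "M \<in> carrier_mat n n \<Longrightarrow> \<sigma> M \<in> carrier_mat n n"
  by (simp add: tens_map_def ad_involution_diag)

lemma sigma_dim [simp]: "M \<in> carrier_mat n n \<Longrightarrow> dim_row (\<sigma> M) = n \<and> dim_col (\<sigma> M) = n"
  using sigma_carrier carrier_matD by blast

text \<open>The signs of \<open>quat_conj\<close> on \<open>i\<close>, \<open>j\<close>,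
  \<open>k\<close> recombine the four coordinate matrices into the conjugate of a single entry.
  Later computations use this formula in place of \<open>tens_map\<close>.\<close>

lemma sigma_index:
  assumes "M \<in> carrier_mat n n" "i < n" "j < n"
  shows "\<sigma> M $$ (i, j) = quat_of (g i / g j) * quat_conj (M $$ (j, i))"
  using assms by (simp add: tens_map_def ad_involution_diag tens_def quat_conj_def quat_of_def
      quat_defs quat_I_def quat_J_def quat_K_def)

lemma sigma_mult_index:
  assumes "M \<in> carrier_mat n n" "N \<in> carrier_mat n n" "i < n" "j < n"
  shows "(\<sigma> M * N) $$ (i, j) = (\<Sum>l<n. quat_of (g i / g l) * quat_conj (M $$ (l, i)) * N $$ (l, j))"
  using assms sigma_dim[of M] by (auto simp: scalar_prod_def atLeast0LessThan sigma_index intro!: sum.cong)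

lemma involution_sigma: "involution_first_kind (quat_scalar n) (mat_alg TYPE('f quat) n) \<sigma>"
  unfolding involution_first_kind_def ring_mat_simps
proof (intro conjI ballI allI)
  fix x y :: "'f quat mat" assume x: "x \<in> carrier_mat n n" and y: "y \<in> carrier_mat n n"
  show "\<sigma> (x + y) = \<sigma> x + \<sigma> y"
    using x y by (intro eq_matI) (auto simp: sigma_index quat_conj_add distrib_left)
  show "\<sigma> (x * y) = \<sigma> y * \<sigma> x"
  proof (rule eq_matI)
    fix i j assume "i < dim_row (\<sigma> y * \<sigma> x)" "j < dim_col (\<sigma> y * \<sigma> x)"
    then have ij: "i < n" "j < n" using x y by auto
    have "(\<sigma> y * \<sigma> x) $$ (i, j) =
        (\<Sum>l<n. quat_of (g i / g l) * quat_conj (y $$ (l, i)) * (quat_of (g l / g j) * quat_conj (x $$ (j, l))))"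
      using x y ij by (subst sigma_mult_index) (auto simp: sigma_index)
    \<comment> \<open>The quotients \<open>g i / g l\<close> and \<open>g l / g j\<close> telescope,
      and conjugation reverses the product.\<close>
    also have "\<dots> = (\<Sum>l<n. quat_of (g i / g j) * quat_conj (x $$ (j, l) * y $$ (l, i)))"
      by (intro sum.cong) (auto simp: quat_of_mult_shuffle quat_conj_mult g)
    also have "\<dots> = \<sigma> (x * y) $$ (i, j)"
      using x y ij by (simp add: sigma_index[of "x * y"] scalar_prod_def atLeast0LessThan quat_conj_sum sum_distrib_left)
    finally show "\<sigma> (x * y) $$ (i, j) = (\<sigma> y * \<sigma> x) $$ (i, j)" by simp
  qed (use x y in auto)
next
  fix x :: "'f quat mat" assume x: "x \<in> carrier_mat n n"
  show "\<sigma> (\<sigma> x) = x"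
  proof (rule eq_matI)
    fix i j assume "i < dim_row x" "j < dim_col x"
    then have ij: "i < n" "j < n" using x by auto
    have comm: "y * quat_of c = quat_of c * y" for c and y :: "'f quat"
      by (simp add: quat_defs quat_of_def mult.commute)
    have "\<sigma> (\<sigma> x) $$ (i, j) = quat_of (g i / g j) * (quat_of (g j / g i) * x $$ (i, j))"
      using x ij by (simp add: sigma_index quat_conj_mult quat_conj_of quat_conj_conj comm[of "x $$ (i, j)"])
    then show "\<sigma> (\<sigma> x) $$ (i, j) = x $$ (i, j)"
      using g[OF ij(1)] g[OF ij(2)] by (simp add: mult.assoc[symmetric] quat_of_mult quat_of_1)
  qed (use x in auto)
next
  fix c
  show "\<sigma> (quat_scalar n c) = quat_scalar n c"
    using g by (intro eq_matI) (auto simp: sigma_index quat_scalar_def scalar_mat_def quat_conj_of quat_conj_zero quat_of_1)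
qed auto

lemma sigma_scalar: "\<sigma> (quat_scalar n c) = quat_scalar n c"
  using involution_sigma by (auto simp: involution_first_kind_def)

end

section \<open>The alternating form to which the extended involution is adjoint\<close>

definition pair_swap :: "nat \<Rightarrow> nat" where
  "pair_swap i = (if even i then i + 1 else i - 1)"

definition pair_sign :: "nat \<Rightarrow> 'a::ring_1" where
  "pair_sign i = (if even i then 1 else - 1)"

lemma pair_swap_less: "i < 2 * n \<Longrightarrow> pair_swap i < 2 * n" "i < n * 2 \<Longrightarrow> pair_swap i < n * 2"
  by (cases "even i"; auto simp: pair_swap_def elim!: evenE)+

lemma pair_swap_swap: "pair_swap (pair_swap i) = i"
  by (cases "even i") (auto simp: pair_swap_def odd_pos)

lemma pair_swap_div: "pair_swap i div 2 = i div 2"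
  by (cases "even i") (auto simp: pair_swap_def elim!: oddE)

lemma pair_swap_mod: "pair_swap i mod 2 = 1 - i mod 2"
  by (cases "even i") (auto simp: pair_swap_def elim!: oddE evenE)

lemma sum_pair_swap:
  fixes f :: "nat \<Rightarrow> 'a::comm_monoid_add"
  shows "(\<Sum>i<2 * n. f (pair_swap i)) = (\<Sum>i<2 * n. f i)"
  unfolding sum_double by (simp add: pair_swap_def add.commute)

locale diagonal_splitting = quat_splitting h \<iota> + diagonal_form n g
  for h :: "'f::field \<Rightarrow> 'l::field" and \<iota> and n and g :: "nat \<Rightarrow> 'f"
begin

text \<open>In 2 by 2 blocks: the block at \<open>(a, b)\<close> is \<open>g a / g b\<close> times
  the adjugate of the block of \<open>M\<close> at \<open>(b, a)\<close>.\<close>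

definition \<tau> :: "'l mat \<Rightarrow> 'l mat" where
  "\<tau> M = mat (2 * n) (2 * n) (\<lambda>(i, j). h (g (i div 2) / g (j div 2)) * pair_sign i * pair_sign j *
    M $$ (pair_swap j, pair_swap i))"

text \<open>An orthogonal sum of planes with form \<open>x_0 y_1 - x_1 y_0\<close>, the
  \<open>a\<close>-th scaled by \<open>1 / g a\<close>. The weights are inverted because
  \<open>G * Z^t * inverse G\<close> is the adjoint of \<open>Z\<close> for the form with Gram
  matrix \<open>inverse G\<close>.\<close>

definition \<beta> :: "'l vec \<Rightarrow> 'l vec \<Rightarrow> 'l" where
  "\<beta> x y = (\<Sum>i<2 * n. h (inverse (g (i div 2))) * pair_sign i * (x $ i * y $ pair_swap i))"

text \<open>Under the representation, quaternion conjugation is the adjugate of 2 by 2 matrices: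
  diagonal entries are exchanged and off-diagonal ones negated.\<close>

lemma rep_conj:
  assumes "u < 2" "v < 2"
  shows "\<rho> (quat_of c * quat_conj x) u v = h c * pair_sign u * pair_sign v * \<rho> x (1 - v) (1 - u)"
  using assms by (auto simp: less_2_cases_iff quat_rep_def quat_of_def quat_conj_def quat_defs pair_sign_def
      h_mult h_minus h_zero algebra_simps)

lemma extended_map_\<tau>: "extended_map (mat_alg TYPE('f quat) n) \<sigma> (2 * n) (\<phi> n) \<tau>"
  unfolding extended_map_def ring_mat_simps
proof (intro conjI ballI allI)
  fix M N :: "'l mat" and l assume M: "M \<in> carrier_mat (2 * n) (2 * n)"
  show "\<tau> M \<in> carrier_mat (2 * n) (2 * n)" by (simp add: \<tau>_def)
  show "\<tau> (l \<cdot>\<^sub>m M) = l \<cdot>\<^sub>m \<tau> M"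
    using M by (intro eq_matI) (auto simp: \<tau>_def pair_swap_less)
  assume N: "N \<in> carrier_mat (2 * n) (2 * n)"
  show "\<tau> (M + N) = \<tau> M + \<tau> N"
    using M N by (intro eq_matI) (auto simp: \<tau>_def pair_swap_less algebra_simps)
next
  fix x :: "'f quat mat" assume x: "x \<in> carrier_mat n n"
  have sgn: "pair_sign (i mod 2) = (pair_sign i :: 'l)" for i
    by (simp add: pair_sign_def)
  show "\<tau> (\<phi> n x) = \<phi> n (\<sigma> x)"
    using x by (intro eq_matI)
      (auto simp: \<tau>_def mat_rep_index pair_swap_less pair_swap_div pair_swap_mod sigma_index div_less rep_conj sgn)
qed

lemma alternating_\<beta>: "alternating_form (2 * n) \<beta>"
  unfolding alternating_form_def bilinear_form_def
proof (intro conjI ballI allI)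
  fix x y z :: "'l vec" and c
  assume x: "x \<in> carrier_vec (2 * n)" and y: "y \<in> carrier_vec (2 * n)" and z: "z \<in> carrier_vec (2 * n)"
  show "\<beta> (x + y) z = \<beta> x z + \<beta> y z" "\<beta> z (x + y) = \<beta> z x + \<beta> z y"
    "\<beta> (c \<cdot>\<^sub>v x) y = c * \<beta> x y" "\<beta> x (c \<cdot>\<^sub>v y) = c * \<beta> x y"
    unfolding \<beta>_def sum.distrib[symmetric] sum_distrib_left
    using x y z by (auto intro!: sum.cong simp: pair_swap_less algebra_simps)
next
  fix x :: "'l vec" assume "x \<in> carrier_vec (2 * n)"
  show "\<beta> x x = 0"
    unfolding \<beta>_def sum_double by (simp add: pair_swap_def pair_sign_def mult.commute)
qed

lemma h_inverse: "c \<noteq> 0 \<Longrightarrow> h (inverse c) * h c = 1"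
  using h_mult[of "inverse c" c] by (simp add: h_one)

lemma nonsingular_\<beta>: "nonsingular_form (2 * n) \<beta>"
  unfolding nonsingular_form_def
proof (intro ballI impI)
  fix x :: "'l vec" assume x: "x \<in> carrier_vec (2 * n)" "x \<noteq> 0\<^sub>v (2 * n)"
  then obtain i where i: "i < 2 * n" "x $ i \<noteq> 0"
    by (metis carrier_vecD eq_vecI index_zero_vec)
  have inj: "pair_swap k = pair_swap i \<longleftrightarrow> k = i" for k
    by (metis pair_swap_swap)
  \<comment> \<open>Pairing with the unit vector at the partner index isolates the nonzero
    coordinate \<open>x $ i\<close>.\<close>
  let ?y = "unit_vec (2 * n) (pair_swap i) :: 'l vec"
  have "\<beta> x ?y = (\<Sum>k<2 * n. if k = i then h (inverse (g (i div 2))) * pair_sign i * x $ i else 0)"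
    unfolding \<beta>_def using i by (intro sum.cong) (auto simp: pair_swap_less inj)
  also have "\<dots> = h (inverse (g (i div 2))) * pair_sign i * x $ i"
    using i by simp
  also have "\<dots> \<noteq> 0"
    using i h_inverse[OF g[OF div_less[OF i(1)]]] by (auto simp: pair_sign_def)
  finally show "\<exists>y\<in>carrier_vec (2 * n). \<beta> x y \<noteq> 0" by (intro bexI[of _ ?y]) auto
qed

lemma adjoint_\<tau>: "adjoint_to_form (2 * n) \<beta> \<tau>"
  unfolding adjoint_to_form_def
proof (intro ballI conjI)
  fix M :: "'l mat" and x y :: "'l vec"
  assume M: "M \<in> carrier_mat (2 * n) (2 * n)"
  show "\<tau> M \<in> carrier_mat (2 * n) (2 * n)" by (simp add: \<tau>_def)
  assume x: "x \<in> carrier_vec (2 * n)" and y: "y \<in> carrier_vec (2 * n)"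
  let ?w = "\<lambda>i. h (inverse (g (i div 2)))" and ?s = "\<lambda>i. pair_sign i :: 'l" and ?p = pair_swap
  have wt: "?w i * h (g (i div 2) / g (j div 2)) = ?w j" if "i < 2 * n" for i j
    unfolding h_mult[symmetric] using g[OF div_less[OF that]] by (simp add: field_simps)
  have ss: "?s i * ?s i = 1" for i by (simp add: pair_sign_def)
  have "\<beta> x (M *\<^sub>v y) = (\<Sum>j<2 * n. ?w j * ?s j * (x $ j * (\<Sum>i<2 * n. M $$ (?p j, i) * y $ i)))"
    unfolding \<beta>_def using M x y by (intro sum.cong) (auto simp: pair_swap_less scalar_prod_def atLeast0LessThan)
  \<comment> \<open>Summing over partners produces the entry \<open>M $$ (?p j, ?p i)\<close> that
    occurs in \<open>\<tau> M $$ (i, j)\<close>.\<close>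
  also have "\<dots> = (\<Sum>j<2 * n. ?w j * ?s j * (x $ j * (\<Sum>i<2 * n. M $$ (?p j, ?p i) * y $ ?p i)))"
    by (subst sum_pair_swap[symmetric]) (rule refl)
  also have "\<dots> = (\<Sum>j<2 * n. \<Sum>i<2 * n. ?w j * ?s j * x $ j * M $$ (?p j, ?p i) * y $ ?p i)"
    by (simp add: sum_distrib_left mult.assoc)
  also have "\<dots> = (\<Sum>i<2 * n. \<Sum>j<2 * n. ?w j * ?s j * x $ j * M $$ (?p j, ?p i) * y $ ?p i)"
    by (rule sum.swap)
  \<comment> \<open>Trading \<open>?w j\<close> for \<open>?w i\<close> and inserting a squared sign
    supplies the remaining weight and signs of \<open>\<tau>\<close>.\<close>
  also have "\<dots> = (\<Sum>i<2 * n. \<Sum>j<2 * n. (?w i * h (g (i div 2) / g (j div 2))) * (?s i * ?s i) * ?s j * x $ j * M $$ (?p j, ?p i) * y $ ?p i)"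
    by (intro sum.cong) (auto simp: wt ss)
  also have "\<dots> = (\<Sum>i<2 * n. ?w i * ?s i * ((\<Sum>j<2 * n. \<tau> M $$ (i, j) * x $ j) * y $ ?p i))"
    by (intro sum.cong) (auto simp: \<tau>_def sum_distrib_left sum_distrib_right mult_ac intro!: sum.cong)
  also have "\<dots> = \<beta> (\<tau> M *\<^sub>v x) y"
    unfolding \<beta>_def using x by (intro sum.cong) (auto simp: \<tau>_def scalar_prod_def atLeast0LessThan)
  finally show "\<beta> x (M *\<^sub>v y) = \<beta> (\<tau> M *\<^sub>v x) y" .
qed

end

lemma (in diagonal_form) symplectic_sigma:
  assumes "(2 :: 'f) \<noteq> 0"
  shows "symplectic (quat_scalar n) (mat_alg TYPE('f quat) n) \<sigma>"
proof -
  obtain \<iota> where "quat_splitting (to_ac :: 'f \<Rightarrow> 'f alg_closure) \<iota>"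
    using to_ac_quat_splitting[OF assms] by blast
  then interpret S: diagonal_splitting to_ac \<iota> n g
    unfolding diagonal_splitting_def using diagonal_form_axioms by blast
  show ?thesis
    unfolding symplectic_def splitting_def
    using involution_sigma S.scalar_extension_mat_rep[OF n] S.extended_map_\<tau> S.alternating_\<beta>
      S.nonsingular_\<beta> S.adjoint_\<tau> by blast
qed

section \<open>Central simplicity and hermitian squares\<close>

lemma mult_mat_unit:
  fixes M :: "'r::ring_1 mat"
  assumes "M \<in> carrier_mat n n" "a < n"
  shows "M * mat_unit n a b r = mat n n (\<lambda>(i, j). if j = b then M $$ (i, a) * r else 0)"
proof -
  have "(\<Sum>l<n. M $$ (i, l) * (if l = a \<and> j = b then r else 0)) = (if j = b then M $$ (i, a) * r else 0)" for i j
    using assms(2) by (subst sum.remove[of _ a]) auto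
  then show ?thesis
    using assms by (intro eq_matI) (auto simp: scalar_prod_def atLeast0LessThan)
qed

lemma mat_unit_mult_left:
  fixes M :: "'r::ring_1 mat"
  assumes "M \<in> carrier_mat n n" "b < n"
  shows "mat_unit n a b r * M = mat n n (\<lambda>(i, j). if i = a then r * M $$ (b, j) else 0)"
proof -
  have "(\<Sum>l<n. (if i = a \<and> l = b then r else 0) * M $$ (l, j)) = (if i = a then r * M $$ (b, j) else 0)" for i j
    using assms(2) by (subst sum.remove[of _ b]) auto
  then show ?thesis
    using assms by (intro eq_matI) (auto simp: scalar_prod_def atLeast0LessThan)
qed

text \<open>Matrix units move a nonzero entry of an element of the ideal, scaled to 1, to every
  diagonal position; these matrices add up to the identity.\<close>

lemma simple_ring_mat:
  assumes n: "n > 0" and inv: "\<And>x :: 'r::ring_1. x \<noteq> 0 \<Longrightarrow> \<exists>y. y * x = 1"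
  shows "simple_ring (mat_alg TYPE('r) n)"
  unfolding simple_ring_def
proof (intro conjI allI impI ring_mat_ring)
  have "(1\<^sub>m n :: 'r mat) $$ (0, 0) \<noteq> 0\<^sub>m n n $$ (0, 0)" using n by simp
  then show "\<one>\<^bsub>mat_alg TYPE('r) n\<^esub> \<noteq> \<zero>\<^bsub>mat_alg TYPE('r) n\<^esub>"
    unfolding ring_mat_simps by metis
next
  fix I assume "ideal I (mat_alg TYPE('r) n)"
  then interpret ideal I "mat_alg TYPE('r) n" .
  have carI: "x \<in> carrier_mat n n" if "x \<in> I" for x
    using a_subset that by (auto simp: ring_mat_simps)
  show "I = {\<zero>\<^bsub>mat_alg TYPE('r) n\<^esub>} \<or> I = carrier (mat_alg TYPE('r) n)"
  proof (cases "I \<subseteq> {\<zero>\<^bsub>mat_alg TYPE('r) n\<^esub>}")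
    case True
    then show ?thesis using additive_subgroup.zero_closed[OF is_additive_subgroup] by blast
  next
    case False
    then obtain x where x: "x \<in> I" "x \<noteq> 0\<^sub>m n n" by (auto simp: ring_mat_simps)
    have "\<exists>a b. a < n \<and> b < n \<and> x $$ (a, b) \<noteq> 0"
    proof (rule ccontr)
      assume "\<not> ?thesis"
      then have "x = 0\<^sub>m n n" using carI[OF x(1)] by (intro eq_matI) auto
      with x(2) show False ..
    qed
    then obtain a b where ab: "a < n" "b < n" "x $$ (a, b) \<noteq> 0" by blast
    obtain y where y: "y * x $$ (a, b) = 1" using inv[OF ab(3)] by blast
    have diag: "mat_unit n c c 1 \<in> I" if "c < n" for c
    proof -
      have "mat_unit n c a y * x * mat_unit n b c 1 \<in> I"
        using I_l_closed[OF x(1), of "mat_unit n c a y"]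
          I_r_closed[of "mat_unit n c a y * x" "mat_unit n b c 1"] by (simp add: ring_mat_simps)
      moreover have "mat_unit n c a y * x * mat_unit n b c 1 = mat_unit n c c 1"
        unfolding mat_unit_mult_left[OF carI[OF x(1)] ab(1)] using ab(2) y
        by (subst mult_mat_unit) (auto intro!: eq_matI)
      ultimately show ?thesis by simp
    qed
    have partial: "mat n n (\<lambda>(i, j). if i = j \<and> i < k then 1 else 0) \<in> I" if "k \<le> n" for k
      using that
    proof (induction k)
      case 0
      have 0: "mat n n (\<lambda>(i, j). if i = j \<and> i < (0 :: nat) then 1 else 0) = 0\<^sub>m n n" by (intro eq_matI) auto
      show ?case unfolding 0 using additive_subgroup.zero_closed[OF is_additive_subgroup] by (simp add: ring_mat_simps)
    next
      case (Suc k)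
      have "mat n n (\<lambda>(i, j). if i = j \<and> i < Suc k then 1 else 0) =
          mat n n (\<lambda>(i, j). if i = j \<and> i < k then 1 else 0) + mat_unit n k k (1 :: 'r)"
        by (intro eq_matI) auto
      then show ?case
        using Suc additive_subgroup.a_closed[OF is_additive_subgroup, of "mat n n (\<lambda>(i, j). if i = j \<and> i < k then 1 else 0)" "mat_unit n k k 1"] diag[of k]
        by (simp add: ring_mat_simps)
    qed
    have "mat n n (\<lambda>(i, j). if i = j \<and> i < n then 1 else 0) = (1\<^sub>m n :: 'r mat)" by (intro eq_matI) auto
    then have "\<one>\<^bsub>mat_alg TYPE('r) n\<^esub> \<in> I" using partial[of n] by (simp add: ring_mat_simps)
    then show ?thesis using one_imp_carrier by blast
  qed
qed

text \<open>Commuting with \<open>i\<close> makes the \<open>j\<close> and \<open>k\<close>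
  coordinates equal to their negatives, and commuting with \<open>j\<close> does the same to the
  \<open>i\<close> coordinate.\<close>

lemma quat_central_iff:
  fixes w :: "'f::field quat"
  assumes "(2 :: 'f) \<noteq> 0" and comm: "\<And>x. w * x = x * w"
  shows "w = quat_of (q1 w)"
proof -
  have z: "x = 0" if "x = - x" for x :: 'f
  proof -
    have "2 * x = 0" using that by (metis add.right_inverse mult_2)
    then show ?thesis using assms(1) by simp
  qed
  show ?thesis
    using comm[of quat_I] comm[of quat_J]
    by (auto simp: quat_eq_iff quat_of_def quat_defs quat_I_def quat_J_def intro!: z)
qed

lemma ring_center_quat_mat:
  assumes n: "n > 0" and two: "(2 :: 'f::field) \<noteq> 0"
  shows "ring_center (mat_alg TYPE('f quat) n) = range (quat_scalar n)"
proof
  show "range (quat_scalar n) \<subseteq> ring_center (mat_alg TYPE('f quat) n)"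
    using quat_scalars.field_algebra_mat[where 'l = 'f, of n]
    by (auto simp: ring_center_def field_algebra_def ring_mat_simps quat_scalar_def)
next
  show "ring_center (mat_alg TYPE('f quat) n) \<subseteq> range (quat_scalar n)"
  proof
    fix z assume "z \<in> ring_center (mat_alg TYPE('f quat) n)"
    then have z: "z \<in> carrier_mat n n" and comm: "\<And>x. x \<in> carrier_mat n n \<Longrightarrow> z * x = x * z"
      by (auto simp: ring_center_def ring_mat_simps)
    have entry: "(if j = b then z $$ (i, a) * r else 0) = (if i = a then r * z $$ (b, j) else 0)"
      if "a < n" "b < n" "i < n" "j < n" for a b i j r
    proof -
      have "(z * mat_unit n a b r) $$ (i, j) = (mat_unit n a b r * z) $$ (i, j)" by (simp add: comm)
      then show ?thesis using that z by (simp add: mult_mat_unit mat_unit_mult_left)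
    qed
    define w where "w = z $$ (0, 0)"
    \<comment> \<open>Column 0 of the two products with the matrix unit at \<open>(a, 0)\<close>
      reads off \<open>z $$ (i, a)\<close>: zero off the diagonal, \<open>z $$ (0, 0)\<close> on
      it.\<close>
    have off: "z $$ (i, a) = 0" if "i < n" "a < n" "i \<noteq> a" for i a
      using entry[of a 0 i 0 1] that n by auto
    have dg: "z $$ (a, a) = w" if "a < n" for a
      using entry[of a 0 a 0 1] that n by (auto simp: w_def)
    have "w * r = r * w" for r
      using entry[of 0 0 0 0 r] n by (auto simp: w_def)
    then have w: "w = quat_of (q1 w)" by (rule quat_central_iff[OF two])
    have "z = quat_scalar n (q1 w)"
      using z off dg w by (intro eq_matI) (auto simp: quat_scalar_def scalar_mat_def)
    then show "z \<in> range (quat_scalar n)" by blast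
  qed
qed

lemma quat_mat_dimension:
  assumes "n > 0"
  shows "ring.dimension (mat_alg TYPE('f::field quat) n) (4 * n\<^sup>2) (range (quat_scalar n)) (carrier (mat_alg TYPE('f quat) n))"
proof -
  have "quat_scalar n = (\<lambda>c :: 'f. scalar_mat n (quat_of c))" by (simp add: fun_eq_iff quat_scalar_def)
  then show ?thesis
    using quat_scalars.algebra_basis_dimension[where 'l = 'f, OF assms, of "quat_mat_basis n"] quat_mat_basis[OF assms, where 'l = 'f]
    by simp
qed

lemma central_simple_quat_mat:
  assumes "n > 0" "(2 :: 'f::field) \<noteq> 0" "\<And>x :: 'f quat. x \<noteq> 0 \<Longrightarrow> \<exists>y. y * x = 1"
  shows "central_simple (quat_scalar n) (mat_alg TYPE('f quat) n)"
  unfolding central_simple_def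
proof (intro conjI exI)
  have "quat_scalar n = (\<lambda>c :: 'f. scalar_mat n (quat_of c))" by (simp add: fun_eq_iff quat_scalar_def)
  then show "field_algebra (quat_scalar n) (mat_alg TYPE('f quat) n)"
    using quat_scalars.field_algebra_mat by simp
qed (rule simple_ring_mat ring_center_quat_mat quat_mat_dimension assms; assumption?)+

section \<open>Quaternion norms on the diagonal of hermitian squares\<close>

definition qnorm :: "'f::field quat \<Rightarrow> 'f" where
  "qnorm x = q1 x * q1 x + qi x * qi x + qj x * qj x + qk x * qk x"

lemma q1_sum: "q1 (\<Sum>i\<in>I. f i) = (\<Sum>i\<in>I. q1 (f i :: 'f::comm_ring_1 quat))"
  by (induction I rule: infinite_finite_induct) (simp_all add: zero_quat_def plus_quat_def)

lemma q1_conj_norm: "q1 (quat_of c * quat_conj x * x) = c * qnorm x"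
  by (simp add: mult.assoc quat_norm qnorm_def) (simp add: quat_of_def quat_defs)

lemma (in diagonal_form) q1_sigma_mult:
  assumes "M \<in> carrier_mat n n" "a < n"
  shows "q1 ((\<sigma> M * M) $$ (a, a)) = (\<Sum>l<n. g a / g l * qnorm (M $$ (l, a)))"
  using assms by (simp add: sigma_mult_index q1_sum q1_conj_norm del: index_mult_mat)

lemma finsum_ring_mat_index:
  fixes f :: "nat \<Rightarrow> 'r::ring_1 mat"
  assumes "\<And>k. k < m \<Longrightarrow> f k \<in> carrier_mat n n" "i < n" "j < n"
  shows "finsum (mat_alg TYPE('r) n) f {..<m} $$ (i, j) = (\<Sum>k<m. f k $$ (i, j))"
  using assms(1)
proof (induction m)
  case 0
  interpret A: ring "mat_alg TYPE('r) n" by (rule ring_mat_ring)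
  show ?case using assms(2,3) A.finsum_empty[of f] by (simp add: ring_mat_simps)
next
  case (Suc m)
  interpret A: ring "mat_alg TYPE('r) n" by (rule ring_mat_ring)
  have car: "finsum (mat_alg TYPE('r) n) f {..<m} \<in> carrier_mat n n"
    using A.finsum_closed[of f "{..<m}"] Suc.prems by (auto simp: ring_mat_simps)
  have "finsum (mat_alg TYPE('r) n) f {..<Suc m} = f m + finsum (mat_alg TYPE('r) n) f {..<m}"
    using A.finsum_insert[of "{..<m}" m f] Suc.prems by (auto simp: ring_mat_simps lessThan_Suc)
  then show ?case using Suc assms(2,3) car by (simp add: add.commute)
qed

section \<open>Field orderings and small characteristics\<close>

lemma field_ordering_square:
  assumes "field_ordering leq"
  shows "leq 0 (x * x)"
proof -
  interpret L: linorder leq "\<lambda>x y. leq x y \<and> x \<noteq> y" using assms by (simp add: field_ordering_def)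
  have add: "\<And>x y z. leq x y \<Longrightarrow> leq (x + z) (y + z)" and mult: "\<And>x y. leq 0 x \<Longrightarrow> leq 0 y \<Longrightarrow> leq 0 (x * y)"
    using assms by (auto simp: field_ordering_def)
  show ?thesis
  proof (cases "leq 0 x")
    case False
    then have "leq (x + - x) (0 + - x)" using L.linear add by blast
    then show ?thesis using mult[of "- x" "- x"] by simp
  qed (rule mult)
qed

text \<open>Strips the factor 2 from the reduced trace: for negative \<open>x\<close>, the chain
  \<open>2 * x \<le> x \<le> 0\<close> together with \<open>0 \<le> 2 * x\<close> would force
  \<open>2 * x = 0\<close>.\<close>

lemma field_ordering_half:
  assumes "field_ordering leq" "leq 0 (2 * x)" "(2 :: 'f::field) \<noteq> 0"
  shows "leq 0 (x :: 'f)"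
proof (rule ccontr)
  interpret L: linorder leq "\<lambda>x y. leq x y \<and> x \<noteq> y" using assms by (simp add: field_ordering_def)
  assume n: "\<not> leq 0 x"
  then have x: "leq x 0" using L.linear by blast
  have "leq (x + x) (0 + x)" using assms(1) x unfolding field_ordering_def by blast
  then have "leq (x + x) x" by (simp only: add_0)
  from L.order.trans[OF this x] have "leq (2 * x) 0" by (simp only: mult_2)
  from L.order.antisym[OF this assms(2)] have "2 * x = 0" .
  then show False using n assms(3) by simp
qed

text \<open>If 2 or 3 vanished, then \<open>(1, 1, 0, 0)\<close> or \<open>(1, 1, 1, 0)\<close>
  would be an isotropic vector.\<close>

lemma anisotropic4_char:
  assumes "anisotropic4 TYPE('a::field)"
  shows "(2 :: 'a) \<noteq> 0" "(3 :: 'a) \<noteq> 0"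
proof -
  have "(1 :: 'a) * 1 + 1 * 1 + 0 * 0 + 0 * 0 \<noteq> 0" "(1 :: 'a) * 1 + 1 * 1 + 1 * 1 + 0 * 0 \<noteq> 0"
    using assms[unfolded anisotropic4_def, rule_format, of 1 1 0 0] assms[unfolded anisotropic4_def, rule_format, of 1 1 1 0]
    by (metis zero_neq_one)+
  then show "(2 :: 'a) \<noteq> 0" "(3 :: 'a) \<noteq> 0" by simp_all
qed

theorem theorem3p3:
  assumes "formally_real TYPE('a::field)"
  shows "central_simple emb_A (alg_A :: 'a ratfun2 quat mat ring) \<and>
    has_degree emb_A (alg_A :: 'a ratfun2 quat mat ring) 6 \<and>
    symplectic emb_A (alg_A :: 'a ratfun2 quat mat ring) sigma_A \<and>
    totally_sigma_positive emb_A (alg_A :: 'a ratfun2 quat mat ring) sigma_A (emb_A (var_X * var_Y)) \<and>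
    \<not> sum_hermitian_squares (alg_A :: 'a ratfun2 quat mat ring) sigma_A (emb_A (var_X * var_Y))"
proof -
  have "anisotropic4 TYPE('a ratfun2)"
    using assms by (intro anisotropic4_fract anisotropic4_poly formally_real_anisotropic4)
  note two = anisotropic4_char(1)[OF this] and three = anisotropic4_char(2)[OF this]
  define g :: "nat \<Rightarrow> 'a ratfun2" where "g i = [var_X, var_Y, var_X * var_Y] ! i" for i
  have XY: "(var_X :: 'a ratfun2) \<noteq> 0" "(var_Y :: 'a ratfun2) \<noteq> 0"
    by (simp_all add: var_X_def var_Y_def Zero_fract_def eq_fract)
  interpret diagonal_form 3 g
    using XY by unfold_locales (auto simp: g_def numeral_eq_Suc less_Suc_eq)
  have sum3: "(\<Sum>a<3. f a) = f 0 + f 1 + f 2" for f :: "nat \<Rightarrow> 'a ratfun2"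
    by (simp add: numeral_eq_Suc)
  have sigma: "sigma_A = \<sigma>"
    by (simp add: sigma_A_def gram_q_def g_def[abs_def])
  obtain \<iota> where "quat_splitting (to_ac :: 'a ratfun2 \<Rightarrow> 'a ratfun2 alg_closure) \<iota>"
    using to_ac_quat_splitting[OF two] by blast
  then have "splitting to_ac emb_A (alg_A :: 'a ratfun2 quat mat ring) (2 * 3) (mat_rep to_ac \<iota> 3)"
    unfolding splitting_def by (rule quat_splitting.scalar_extension_mat_rep) simp
  note Trd = Trd_quat_mat[OF this two three]
  have Trd_smult: "Trd emb_A (alg_A :: 'a ratfun2 quat mat ring) (\<sigma> x * emb_A c * x) =
      c * Trd emb_A (alg_A :: 'a ratfun2 quat mat ring) (\<sigma> x * x)" if x: "x \<in> carrier_mat 3 3" for c x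
  proof -
    have "\<sigma> x * emb_A c = emb_A c * \<sigma> x"
      using quat_scalars.field_algebra_mat[where 'l = "'a ratfun2", of 3] sigma_carrier[OF x]
      by (simp add: field_algebra_def ring_mat_simps quat_scalar_def)
    then have "\<sigma> x * emb_A c * x = emb_A c * (\<sigma> x * x)"
      using x sigma_carrier[OF x] by (simp add: quat_scalar_def assoc_mult_mat[of _ 3 3 _ 3 _ 3])
    also have "\<dots> = quat_of c \<cdot>\<^sub>m (\<sigma> x * x)"
      unfolding quat_scalar_def by (rule scalar_mat_mult[OF mult_carrier_mat[OF sigma_carrier[OF x] x]])
    finally have e: "\<sigma> x * emb_A c * x = quat_of c \<cdot>\<^sub>m (\<sigma> x * x)" .
    have car: "\<sigma> x * x \<in> carrier_mat 3 3" by (rule mult_carrier_mat[OF sigma_carrier[OF x] x])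
    have q1c: "q1 (quat_of c * y) = c * q1 y" for y by (simp add: quat_of_def quat_defs)
    show ?thesis
      unfolding e using car carrier_matD[OF car]
      by (simp add: Trd q1c sum_distrib_left mult.left_commute del: index_mult_mat)
  qed
  have "totally_sigma_positive emb_A (alg_A :: 'a ratfun2 quat mat ring) \<sigma> (emb_A (var_X * var_Y))"
    unfolding totally_sigma_positive_def
  proof (intro conjI allI impI)
    show "emb_A (var_X * var_Y) \<in> Sym (alg_A :: 'a ratfun2 quat mat ring) \<sigma>"
      by (simp add: Sym_def ring_mat_simps sigma_scalar) (simp add: quat_scalar_def)
  next
    fix leq assume ord: "sigma_ordering emb_A (alg_A :: 'a ratfun2 quat mat ring) \<sigma> leq"
    then have fo: "field_ordering leq"
      and pos: "\<And>x. x \<in> carrier_mat 3 3 \<Longrightarrow> leq 0 (Trd emb_A (alg_A :: 'a ratfun2 quat mat ring) (\<sigma> x * x))"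
      by (auto simp: sigma_ordering_def ring_mat_simps)
    have mult: "\<And>x y. leq 0 x \<Longrightarrow> leq 0 y \<Longrightarrow> leq 0 (x * y)"
      using fo by (simp add: field_ordering_def)
    \<comment> \<open>For this matrix unit, \<open>\<sigma> ?x * ?x\<close> is
      \<open>g 0 / g 1\<close> times the matrix unit at \<open>(0, 0)\<close>, so its trace isolates
      the quotient \<open>X / Y\<close>.\<close>
    let ?x = "mat_unit 3 1 0 1 :: 'a ratfun2 quat mat"
    have "\<sigma> ?x * ?x \<in> carrier_mat 3 3" using sigma_carrier[of ?x] by (intro mult_carrier_mat[of _ 3 3]) auto
    then have "Trd emb_A (alg_A :: 'a ratfun2 quat mat ring) (\<sigma> ?x * ?x) = 2 * (g 0 / g 1)"
      by (simp add: Trd q1_sigma_mult sum3 qnorm_def quat_defs del: index_mult_mat)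
    then have "leq 0 (g 0 / g 1)"
      using pos[of ?x] field_ordering_half[OF fo _ two] by simp
    \<comment> \<open>Multiplying \<open>X / Y\<close> by the square of \<open>Y\<close> gives
      \<open>X * Y\<close>.\<close>
    then have "leq 0 (g 0 / g 1 * (g 1 * g 1))"
      using mult field_ordering_square[OF fo] by blast
    then have XY_pos: "leq 0 (var_X * var_Y)"
      using XY by (simp add: g_def)
    show "sigma_positive emb_A (alg_A :: 'a ratfun2 quat mat ring) \<sigma> leq (emb_A (var_X * var_Y))"
      unfolding sigma_positive_def ring_mat_simps
      using pos mult XY_pos by (simp add: Trd_smult)
  qed
  moreover have "\<not> sum_hermitian_squares (alg_A :: 'a ratfun2 quat mat ring) \<sigma> (emb_A (var_X * var_Y))"
  proof
    assume "sum_hermitian_squares (alg_A :: 'a ratfun2 quat mat ring) \<sigma> (emb_A (var_X * var_Y))"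
    then obtain m :: nat and x where x: "x \<in> {..<m} \<rightarrow> carrier_mat 3 3"
      and eq: "emb_A (var_X * var_Y) = finsum (alg_A :: 'a ratfun2 quat mat ring) (\<lambda>i. \<sigma> (x i) * x i) {..<m}"
      by (auto simp: sum_hermitian_squares_def ring_mat_simps)
    obtain P :: "'a ratfun2 set" where P: "precone P"
      and no: "\<And>s t u. s \<in> insert 0 P \<Longrightarrow> t \<in> insert 0 P \<Longrightarrow> u \<in> insert 0 P \<Longrightarrow>
        var_X * s + var_Y * t + var_X * var_Y * u \<noteq> 1"
      using one_not_represented[OF assms] by metis
    define s where "s l = (\<Sum>i<m. qnorm (x i $$ (l, 2)))" for l
    \<comment> \<open>Dividing the last diagonal entry by \<open>XY\<close> leaves the terms
      \<open>s l / g l\<close>. Rewriting \<open>1 / g l\<close> as \<open>g l\<close> times the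
      square of \<open>inverse (g l)\<close> gives the shape excluded by \<open>no\<close>.\<close>
    have s: "inverse (g l) * inverse (g l) * s l \<in> insert 0 P" for l
      unfolding s_def qnorm_def
      by (intro precone_mult_square0 precone_sum0 precone_add0 precone_square0 P)
    have "quat_of (var_X * var_Y) = (\<Sum>i<m. (\<sigma> (x i) * x i) $$ (2, 2))"
    proof -
      have "emb_A (var_X * var_Y) $$ (2, 2) = (\<Sum>i<m. (\<sigma> (x i) * x i) $$ (2, 2))"
        unfolding eq
      proof (rule finsum_ring_mat_index)
        fix i assume "i < m"
        then have "x i \<in> carrier_mat 3 3" using x by auto
        then show "\<sigma> (x i) * x i \<in> carrier_mat 3 3" using mult_carrier_mat sigma_carrier by blast
      qed simp_all
      then show ?thesis by (simp add: quat_scalar_def scalar_mat_def)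
    qed
    then have "q1 (quat_of (var_X * var_Y)) = (\<Sum>i<m. q1 ((\<sigma> (x i) * x i) $$ (2, 2)))"
      by (simp only: q1_sum)
    also have "\<dots> = (\<Sum>i<m. \<Sum>l<3. g 2 / g l * qnorm (x i $$ (l, 2)))"
      using x by (intro sum.cong refl q1_sigma_mult) auto
    also have "\<dots> = (\<Sum>l<3. g 2 / g l * s l)"
      unfolding s_def by (subst sum.swap) (simp add: sum_distrib_left)
    finally have XY_eq: "var_X * var_Y = g 2 / g 0 * s 0 + g 2 / g 1 * s 1 + g 2 / g 2 * s 2"
      by (simp add: quat_of_def sum3)
    have "var_X * (inverse (g 0) * inverse (g 0) * s 0) + var_Y * (inverse (g 1) * inverse (g 1) * s 1) +
        var_X * var_Y * (inverse (g 2) * inverse (g 2) * s 2) =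
        (g 2 / g 0 * s 0 + g 2 / g 1 * s 1 + g 2 / g 2 * s 2) / (var_X * var_Y)"
      using XY by (simp add: g_def field_simps)
    also have "\<dots> = 1"
      unfolding XY_eq[symmetric] using XY by simp
    finally have "var_X * (inverse (g 0) * inverse (g 0) * s 0) + var_Y * (inverse (g 1) * inverse (g 1) * s 1) +
        var_X * var_Y * (inverse (g 2) * inverse (g 2) * s 2) = 1" .
    then show False using no[OF s s s] by blast
  qed
  moreover have "has_degree emb_A (alg_A :: 'a ratfun2 quat mat ring) 6"
    using quat_mat_dimension[where 'f = "'a ratfun2", of 3] by (simp add: has_degree_def)
  moreover have "central_simple emb_A (alg_A :: 'a ratfun2 quat mat ring)"
    using quat_division[OF assms] two by (intro central_simple_quat_mat) auto
  ultimately show ?thesis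
    using symplectic_sigma[OF two] unfolding sigma by blast
qed

end
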